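(* Let $(X,x_0)$ and $(Y,y_0)$ be pointed operator metric spaces and let $n\in\mathbb{N}$. For any $L\in\mathrm{Lip}_0(X,Y)$, the cb-norm of the map \[f\in \mathrm{Lip}_0^n(Y,\mathbb{C})\mapsto f\circ L\in\mathrm{Lip}_0^n(X,\mathbb{C})\] equals $\mathrm{Lip}_n(L)$. Moreover, there exists a unique bounded linear map $\tilde L:\mathcal{F}^n(X)\to\mathcal{F}^n(Y)$ such that $\delta_Y^n\circ L=\tilde L\circ\delta_X^n$. Furthermore, $\|\tilde L\|_{\mathrm{cb}}=\mathrm{Lip}_n(L)$.
   Context: An operator metric space is a subset $X\subset\mathcal{B}(H)$, $H$ a (complex) Hilbert space; $\mathrm{M}_n(X)$ has the metric inherited from $\mathcal{B}(H^{\oplus n})$ ($H^{\oplus n}$ the $\ell_2$-sum). A pointed operator metric space is a pair $(X,x_0)$ with $x_0\in X$. For a map $f$, its $n$-th amplification is $f_n([x_{ij}])=[f(x_{ij})]$ and $\mathrm{Lip}_n(f)$ is the Lipschitz constant of $f_n$. $\mathrm{Lip}_0(X,Y)$ is the set of Lipschitz maps $f:X\to Y$ with $f(x_0)=y_0$ (for target $\mathbb{C}$ the distinguished point is $0$). The cb-norm of a linear map $u$ is $\|u\|_{\mathrm{cb}}=\sup_k\|u_k\|$. $\mathrm{Lip}_0^n(X,\mathbb{C})$ is $\mathrm{Lip}_0(X,\mathbb{C})$ with norm $\|f\|_{\mathrm{Lip},n}=\mathrm{Lip}_n(f)$ and operator space structure given, for $[f_{ij}]\in \mathrm{M}_k(\mathrm{Lip}_0(X,\mathbb{C}))$,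 by $\|[f_{ij}]\|_{\mathrm{Lip},n,k}=\mathrm{Lip}_n\big([f_{ij}]:X\to \mathrm{M}_k\big)$, where $[f_{ij}]$ is viewed as the map $x\mapsto[f_{ij}(x)]$. The dual $E^*$ of an operator space $E$ is an operator space via $\mathrm{M}_k(E^* )\cong\mathrm{CB}(E,\mathrm{M}_k)$. For $x\in X$, $\delta_x\in \mathrm{Lip}_0^n(X,\mathbb{C})^*$ is $\delta_x(f)=f(x)$. The $n$-Lipschitz-free operator space is $\mathcal{F}^n(X)=\overline{\mathrm{span}}\{\delta_x: x\in X\}\subset \mathrm{Lip}_0^n(X,\mathbb{C})^*$ with the inherited operator space structure, and $\delta_X^n:X\to\mathcal{F}^n(X)$ is $\delta_X^n(x)=\delta_x$. *)

theory Defs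
  imports "HOL-Analysis.Analysis" "HOL-Library.Function_Algebras"
begin

class complex_hilbert_space = banach +
  fixes scaleC :: "complex \<Rightarrow> 'a \<Rightarrow> 'a"  (infixr "*\<^sub>C" 75)
    and cinner :: "'a \<Rightarrow> 'a \<Rightarrow> complex"
  assumes scaleC_add_right: "a *\<^sub>C (x + y) = a *\<^sub>C x + a *\<^sub>C y"
    and scaleC_add_left: "(a + b) *\<^sub>C x = a *\<^sub>C x + b *\<^sub>C x"
    and scaleC_scaleC: "a *\<^sub>C (b *\<^sub>C x) = (a * b) *\<^sub>C x"
    and scaleC_of_real: "complex_of_real r *\<^sub>C x = r *\<^sub>R x"
    and cinner_commute: "cinner x y = cnj (cinner y x)"
    and cinner_add_left: "cinner (x + y) z = cinner x z + cinner y z"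
    and cinner_scaleC_left: "cinner (a *\<^sub>C x) y = a * cinner x y"
    and cinner_self: "cinner x x = complex_of_real ((norm x)\<^sup>2)"

instantiation complex :: complex_hilbert_space
begin

definition scaleC_complex :: "complex \<Rightarrow> complex \<Rightarrow> complex"
  where "scaleC_complex a x = a * x"

definition cinner_complex :: "complex \<Rightarrow> complex \<Rightarrow> complex"
  where "cinner_complex x y = x * cnj y"

instance
  by standard
    (simp_all add: scaleC_complex_def cinner_complex_def algebra_simps scaleR_conv_of_real
      complex_mult_cnj cmod_power2)

end

text \<open>The type of bounded operators in the library consists of the real-linear ones; \<open>B(H)\<close> is
  the set of those that are complex-linear. The norm is the operator norm in both cases.\<close>

definition bounded_ops :: "('h::complex_hilbert_space \<Rightarrow>\<^sub>L 'h) set"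
  where "bounded_ops = {T. \<forall>c x. blinfun_apply T (c *\<^sub>C x) = c *\<^sub>C blinfun_apply T x}"

definition pointed_operator_metric_space ::
    "('h::complex_hilbert_space \<Rightarrow>\<^sub>L 'h) set \<Rightarrow> ('h \<Rightarrow>\<^sub>L 'h) \<Rightarrow> bool"
  where "pointed_operator_metric_space X x0 \<longleftrightarrow> X \<subseteq> bounded_ops \<and> x0 \<in> X"


section \<open>Matrices\<close>

text \<open>An \<open>n \<times> n\<close> matrix is a function of two indices of which only the values at indices
  below \<open>n\<close> are relevant.\<close>

definition mats :: "nat \<Rightarrow> 'a set \<Rightarrow> (nat \<Rightarrow> nat \<Rightarrow> 'a) set"
  where "mats n S = {A. \<forall>i<n. \<forall>j<n. A i j \<in> S}"

text \<open>The operator norm of the matrix \<open>T\<close> of operators acting on the \<open>\<ell>\<^sub>2\<close>-sum of copies of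
  a space, indexed by the finite set \<open>I\<close>.\<close>

definition mat_opnorm :: "'i set \<Rightarrow> ('i \<Rightarrow> 'i \<Rightarrow> 'h \<Rightarrow> 'h::real_normed_vector) \<Rightarrow> ennreal"
  where "mat_opnorm I T =
    (SUP v \<in> {v. L2_set (\<lambda>j. norm (v j)) I \<le> 1}.
       ennreal (L2_set (\<lambda>i. norm (\<Sum>j\<in>I. T i j (v j))) I))"

definition op_mat_norm :: "nat \<Rightarrow> (nat \<Rightarrow> nat \<Rightarrow> ('h::complex_hilbert_space \<Rightarrow>\<^sub>L 'h)) \<Rightarrow> ennreal"
  where "op_mat_norm n A = mat_opnorm {..<n} (\<lambda>i j. blinfun_apply (A i j))"

text \<open>The Lipschitz constant of the \<open>n\<close>-th amplification of \<open>f\<close> on \<open>X\<close>, where \<open>\<nu>\<close> is the norm on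
  the \<open>n \<times> n\<close> matrices over the target.\<close>

definition lip_amp :: "nat \<Rightarrow> ('h::complex_hilbert_space \<Rightarrow>\<^sub>L 'h) set \<Rightarrow>
    ((nat \<Rightarrow> nat \<Rightarrow> 'b::minus) \<Rightarrow> ennreal) \<Rightarrow> (('h \<Rightarrow>\<^sub>L 'h) \<Rightarrow> 'b) \<Rightarrow> ennreal"
  where "lip_amp n X \<nu> f =
    Inf {C. \<forall>A\<in>mats n X. \<forall>B\<in>mats n X.
      \<nu> (\<lambda>i j. f (A i j) - f (B i j)) \<le> C * op_mat_norm n (\<lambda>i j. A i j - B i j)}"

abbreviation Lip_n :: "nat \<Rightarrow> ('h::complex_hilbert_space \<Rightarrow>\<^sub>L 'h) set \<Rightarrow>
    (('h \<Rightarrow>\<^sub>L 'h) \<Rightarrow> ('k::complex_hilbert_space \<Rightarrow>\<^sub>L 'k)) \<Rightarrow> ennreal"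
  where "Lip_n n X f \<equiv> lip_amp n X (op_mat_norm n) f"

definition Lip0 :: "('h::complex_hilbert_space \<Rightarrow>\<^sub>L 'h) set \<Rightarrow> ('h \<Rightarrow>\<^sub>L 'h) \<Rightarrow>
    ('k::complex_hilbert_space \<Rightarrow>\<^sub>L 'k) set \<Rightarrow> ('k \<Rightarrow>\<^sub>L 'k) \<Rightarrow> (('h \<Rightarrow>\<^sub>L 'h) \<Rightarrow> ('k \<Rightarrow>\<^sub>L 'k)) set"
  where "Lip0 X x0 Y y0 = {f. f ` X \<subseteq> Y \<and> f x0 = y0 \<and> (\<exists>C. C-lipschitz_on X f)}"


section \<open>Matrix-normed spaces\<close>

text \<open>All spaces that occur are spaces of complex-valued functions with pointwise operations.
  A function or functional defined only on a subset is represented by its extension by \<open>0\<close>, so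
  that equality of functions is equality on that subset. The field \<open>mnorm\<close> takes the size of the
  matrix first.\<close>

record 'c mat_normed_space =
  carr :: "('c \<Rightarrow> complex) set"
  mnorm :: "nat \<Rightarrow> (nat \<Rightarrow> nat \<Rightarrow> 'c \<Rightarrow> complex) \<Rightarrow> ennreal"

definition vnorm :: "'c mat_normed_space \<Rightarrow> ('c \<Rightarrow> complex) \<Rightarrow> ennreal"
  where "vnorm E f = mnorm E 1 (\<lambda>_ _. f)"

definition linear_map :: "'c mat_normed_space \<Rightarrow> 'd mat_normed_space \<Rightarrow>
    (('c \<Rightarrow> complex) \<Rightarrow> ('d \<Rightarrow> complex)) \<Rightarrow> bool"
  where "linear_map E F u \<longleftrightarrow> u ` carr E \<subseteq> carr F \<and>
    (\<forall>f\<in>carr E. \<forall>g\<in>carr E. u (f + g) = u f + u g) \<and>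
    (\<forall>c. \<forall>f\<in>carr E. u (\<lambda>x. c * f x) = (\<lambda>x. c * u f x))"

definition bounded_linear_map :: "'c mat_normed_space \<Rightarrow> 'd mat_normed_space \<Rightarrow>
    (('c \<Rightarrow> complex) \<Rightarrow> ('d \<Rightarrow> complex)) \<Rightarrow> bool"
  where "bounded_linear_map E F u \<longleftrightarrow> linear_map E F u \<and>
    (\<exists>C::real. \<forall>f\<in>carr E. vnorm F (u f) \<le> ennreal C * vnorm E f)"

definition amp_norm :: "'c mat_normed_space \<Rightarrow> 'd mat_normed_space \<Rightarrow>
    (('c \<Rightarrow> complex) \<Rightarrow> ('d \<Rightarrow> complex)) \<Rightarrow> nat \<Rightarrow> ennreal"
  where "amp_norm E F u k =
    (SUP A \<in> {A \<in> mats k (carr E). mnorm E k A \<le> 1}. mnorm F k (\<lambda>i j. u (A i j)))"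

definition cb_norm :: "'c mat_normed_space \<Rightarrow> 'd mat_normed_space \<Rightarrow>
    (('c \<Rightarrow> complex) \<Rightarrow> ('d \<Rightarrow> complex)) \<Rightarrow> ennreal"
  where "cb_norm E F u = (SUP k\<in>{1..}. amp_norm E F u k)"

text \<open>The operator space \<open>M\<^sub>k\<close>, normed via \<open>M\<^sub>m(M\<^sub>k) = B((\<complex>\<^sup>k)\<^sup>m)\<close>.\<close>

definition scalar_mats :: "nat \<Rightarrow> (nat \<times> nat) mat_normed_space"
  where "scalar_mats k = \<lparr>
    carr = {a. \<forall>i j. \<not> (i < k \<and> j < k) \<longrightarrow> a (i, j) = 0},
    mnorm = (\<lambda>m A. mat_opnorm ({..<m} \<times> {..<k}) (\<lambda>(p, i) (q, j) z. A p q (i, j) * z))\<rparr>"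

text \<open>A matrix of functions viewed as the matrix-valued function \<open>x \<mapsto> [f\<^sub>i\<^sub>j(x)]\<close>.\<close>

definition mat_fun :: "nat \<Rightarrow> (nat \<Rightarrow> nat \<Rightarrow> 'c \<Rightarrow> complex) \<Rightarrow> 'c \<Rightarrow> (nat \<times> nat \<Rightarrow> complex)"
  where "mat_fun k f x = (\<lambda>(i, j). if i < k \<and> j < k then f i j x else 0)"

definition Lip0_space :: "nat \<Rightarrow> ('h::complex_hilbert_space \<Rightarrow>\<^sub>L 'h) set \<Rightarrow> ('h \<Rightarrow>\<^sub>L 'h) \<Rightarrow>
    ('h \<Rightarrow>\<^sub>L 'h) mat_normed_space"
  where "Lip0_space n X x0 = \<lparr>
    carr = {f. f x0 = 0 \<and> (\<exists>C. C-lipschitz_on X f) \<and> (\<forall>x. x \<notin> X \<longrightarrow> f x = 0)},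
    mnorm = (\<lambda>k f. lip_amp n X (mnorm (scalar_mats k) n) (mat_fun k f))\<rparr>"

definition dual :: "'c mat_normed_space \<Rightarrow> ('c \<Rightarrow> complex) mat_normed_space"
  where "dual E = \<lparr>
    carr = {\<phi>. (\<forall>f\<in>carr E. \<forall>g\<in>carr E. \<phi> (f + g) = \<phi> f + \<phi> g) \<and>
      (\<forall>c. \<forall>f\<in>carr E. \<phi> (\<lambda>x. c * f x) = c * \<phi> f) \<and>
      (\<exists>C::real. \<forall>f\<in>carr E. ennreal (cmod (\<phi> f)) \<le> ennreal C * vnorm E f) \<and>
      (\<forall>f. f \<notin> carr E \<longrightarrow> \<phi> f = 0)},
    mnorm = (\<lambda>k \<Phi>. cb_norm E (scalar_mats k) (mat_fun k \<Phi>))\<rparr>"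

interpretation cfun: vector_space "\<lambda>(c::complex) f (x::'c). c * f x"
  by unfold_locales (auto simp: fun_eq_iff algebra_simps)

definition evaluation :: "nat \<Rightarrow> ('h::complex_hilbert_space \<Rightarrow>\<^sub>L 'h) set \<Rightarrow> ('h \<Rightarrow>\<^sub>L 'h) \<Rightarrow>
    ('h \<Rightarrow>\<^sub>L 'h) \<Rightarrow> (('h \<Rightarrow>\<^sub>L 'h) \<Rightarrow> complex) \<Rightarrow> complex"
  where "evaluation n X x0 x = (\<lambda>f. if f \<in> carr (Lip0_space n X x0) then f x else 0)"

definition free_space :: "nat \<Rightarrow> ('h::complex_hilbert_space \<Rightarrow>\<^sub>L 'h) set \<Rightarrow> ('h \<Rightarrow>\<^sub>L 'h) \<Rightarrow>
    (('h \<Rightarrow>\<^sub>L 'h) \<Rightarrow> complex) mat_normed_space"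
  where "free_space n X x0 = (let D = dual (Lip0_space n X x0) in \<lparr>
    carr = {\<phi> \<in> carr D. \<forall>e>0. \<exists>\<psi> \<in> cfun.span (evaluation n X x0 ` X). vnorm D (\<phi> - \<psi>) < e},
    mnorm = mnorm D\<rparr>)"

definition pullback :: "'a set \<Rightarrow> ('a \<Rightarrow> 'b) \<Rightarrow> ('b \<Rightarrow> complex) \<Rightarrow> 'a \<Rightarrow> complex"
  where "pullback X L f = (\<lambda>x. if x \<in> X then f (L x) else 0)"

text \<open>The linear maps between the free spaces that extend \<open>L\<close>. The map has to be given on the
  free space only; \<^const>\<open>extensional\<close> fixes its values elsewhere, so that uniqueness makes sense.\<close>

definition linearization :: "nat \<Rightarrow> ('h::complex_hilbert_space \<Rightarrow>\<^sub>L 'h) set \<Rightarrow> ('h \<Rightarrow>\<^sub>L 'h) \<Rightarrow>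
    ('k::complex_hilbert_space \<Rightarrow>\<^sub>L 'k) set \<Rightarrow> ('k \<Rightarrow>\<^sub>L 'k) \<Rightarrow> (('h \<Rightarrow>\<^sub>L 'h) \<Rightarrow> ('k \<Rightarrow>\<^sub>L 'k)) \<Rightarrow>
    (((('h \<Rightarrow>\<^sub>L 'h) \<Rightarrow> complex) \<Rightarrow> complex) \<Rightarrow> ((('k \<Rightarrow>\<^sub>L 'k) \<Rightarrow> complex) \<Rightarrow> complex)) \<Rightarrow> bool"
  where "linearization n X x0 Y y0 L T \<longleftrightarrow>
    bounded_linear_map (free_space n X x0) (free_space n Y y0) T \<and>
    T \<in> extensional (carr (free_space n X x0)) \<and>
    (\<forall>x\<in>X. evaluation n Y y0 (L x) = T (evaluation n X x0 x))"

end

theory Submission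
  imports Defs
begin

text \<open>
  Everything rests on one norming property, \<open>op_mat_norm_le_Lip0_unit_ball\<close>: for \<open>A, B \<in> M\<^sub>n(Y)\<close> the
  norm of \<open>A - B\<close> is the supremum of the norms of \<open>[f(A\<^sub>p\<^sub>q) - f(B\<^sub>p\<^sub>q)]\<close>, where \<open>f\<close> runs over the unit
  balls of all \<open>M\<^sub>k(Lip\<^sub>0\<^sup>n(Y, \<complex>))\<close>. The functions that norm \<open>A - B\<close> are the matrix coefficients
  \<open>y \<mapsto> \<langle>(y - y\<^sub>0) e\<^sub>j, e\<^sub>i\<rangle>\<close> of \<open>y - y\<^sub>0\<close> in an orthonormal basis of a finite-dimensional subspace \<open>V\<close>
  of the Hilbert space. As a map into \<open>M\<^sub>k\<close> this is a compression to \<open>V\<close>, hence a complete contraction;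
  and if \<open>V\<close> contains the components of a vector \<open>v\<close> and of \<open>(A - B) v\<close>, the compression does not
  change the length of \<open>(A - B) v\<close>.

  Write \<open>L\<^sup>*\<close> for the pullback \<open>f \<mapsto> f \<circ> L\<close>. Composition of Lipschitz maps gives
  \<open>\<parallel>L\<^sup>*\<parallel>\<^sub>c\<^sub>b \<le> Lip\<^sub>n(L)\<close>. Conversely, \<open>L(A) - L(B)\<close> is normed by the differences
  \<open>f(L(A)) - f(L(B)) = (L\<^sup>* f)(A) - (L\<^sup>* f)(B)\<close>, and these are bounded by
  \<open>\<parallel>L\<^sup>*\<parallel>\<^sub>c\<^sub>b \<parallel>A - B\<parallel>\<close> (\<open>cb_norm_pullback\<close>).

  The extension to the free spaces is the restriction of the Banach space adjoint of \<open>L\<^sup>*\<close>. It sends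
  \<open>\<delta>(x)\<close> to \<open>\<delta>(L(x))\<close>, hence spans to spans, and by boundedness closures to closures. Passing to the
  adjoint does not increase the cb-norm, so the cb-norm of the extension is at most \<open>Lip\<^sub>n(L)\<close>
  (\<open>linearization_Ltilde\<close>, \<open>cb_norm_Ltilde_le\<close>).
  It is unique because the span of the point evaluations is dense
  (\<open>linearization_unique\<close>).

  For the remaining inequality, \<open>\<delta>\<close> is an isometry on \<open>n \<times> n\<close> matrices, in the sense that
  \<open>\<parallel>[\<delta>(A\<^sub>p\<^sub>q) - \<delta>(B\<^sub>p\<^sub>q)]\<parallel> = \<parallel>A - B\<parallel>\<close>: one inequality holds by the definition of the Lipschitz norm, up
  to exchanging the roles of the two matrix indices in \<open>M\<^sub>n(M\<^sub>k)\<close>, and the other is the norming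
  property. An extension maps \<open>\<delta>(A) - \<delta>(B)\<close> to \<open>\<delta>(L(A)) - \<delta>(L(B))\<close>, so its cb-norm bounds \<open>Lip\<^sub>n(L)\<close>
  (\<open>Lip_n_le_cb_norm_linearization\<close>).
\<close>

section \<open>Norms of matrices of operators\<close>

lemma mat_opnorm_le:
  assumes "\<And>v. L2_set (\<lambda>j. norm (v j)) I \<le> 1 \<Longrightarrow>
    ennreal (L2_set (\<lambda>i. norm (\<Sum>j\<in>I. T i j (v j))) I) \<le> b"
  shows "mat_opnorm I T \<le> b"
  unfolding mat_opnorm_def by (rule SUP_least) (use assms in auto)

lemma mat_opnorm_ge:
  assumes "L2_set (\<lambda>j. norm (v j)) I \<le> 1"
  shows "ennreal (L2_set (\<lambda>i. norm (\<Sum>j\<in>I. T i j (v j))) I) \<le> mat_opnorm I T"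
  unfolding mat_opnorm_def by (rule SUP_upper2[of v]) (use assms in auto)

lemma mat_opnorm_cong:
  assumes "\<And>i j. i \<in> I \<Longrightarrow> j \<in> I \<Longrightarrow> T i j = S i j"
  shows "mat_opnorm I T = mat_opnorm I S"
proof -
  have "L2_set (\<lambda>i. norm (\<Sum>j\<in>I. T i j (v j))) I = L2_set (\<lambda>i. norm (\<Sum>j\<in>I. S i j (v j))) I" for v
    by (rule L2_set_cong) (use assms in \<open>auto intro!: arg_cong[of _ _ norm] sum.cong\<close>)
  then show ?thesis
    unfolding mat_opnorm_def by simp
qed

lemma mat_opnorm_add:
  "mat_opnorm I (\<lambda>i j z. T i j z + S i j z) \<le> mat_opnorm I T + mat_opnorm I S"
proof (rule mat_opnorm_le)
  fix v :: "'a \<Rightarrow> 'b"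
  assume v: "L2_set (\<lambda>j. norm (v j)) I \<le> 1"
  let ?t = "\<lambda>i. \<Sum>j\<in>I. T i j (v j)" and ?s = "\<lambda>i. \<Sum>j\<in>I. S i j (v j)"
  have "L2_set (\<lambda>i. norm (\<Sum>j\<in>I. T i j (v j) + S i j (v j))) I
      \<le> L2_set (\<lambda>i. norm (?t i) + norm (?s i)) I"
    by (rule L2_set_mono) (auto simp: sum.distrib norm_triangle_ineq)
  also have "\<dots> \<le> L2_set (\<lambda>i. norm (?t i)) I + L2_set (\<lambda>i. norm (?s i)) I"
    by (rule L2_set_triangle_ineq)
  finally have "ennreal (L2_set (\<lambda>i. norm (\<Sum>j\<in>I. T i j (v j) + S i j (v j))) I)
      \<le> ennreal (L2_set (\<lambda>i. norm (?t i)) I) + ennreal (L2_set (\<lambda>i. norm (?s i)) I)"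
    by (simp flip: ennreal_plus)
  also have "\<dots> \<le> mat_opnorm I T + mat_opnorm I S"
    by (intro add_mono mat_opnorm_ge v)
  finally show "ennreal (L2_set (\<lambda>i. norm (\<Sum>j\<in>I. T i j (v j) + S i j (v j))) I)
      \<le> mat_opnorm I T + mat_opnorm I S" .
qed

lemma mat_opnorm_scale:
  fixes T :: "'i \<Rightarrow> 'i \<Rightarrow> complex \<Rightarrow> complex"
  shows "mat_opnorm I (\<lambda>i j z. c * T i j z) \<le> ennreal (cmod c) * mat_opnorm I T"
proof (rule mat_opnorm_le)
  fix v :: "'i \<Rightarrow> complex"
  assume v: "L2_set (\<lambda>j. norm (v j)) I \<le> 1"
  have "L2_set (\<lambda>i. norm (\<Sum>j\<in>I. c * T i j (v j))) I
      = cmod c * L2_set (\<lambda>i. norm (\<Sum>j\<in>I. T i j (v j))) I"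
    by (simp add: norm_mult L2_set_right_distrib flip: sum_distrib_left)
  then show "ennreal (L2_set (\<lambda>i. norm (\<Sum>j\<in>I. c * T i j (v j))) I)
      \<le> ennreal (cmod c) * mat_opnorm I T"
    using mat_opnorm_ge[OF v, of T] by (simp add: ennreal_mult mult_left_mono)
qed

text \<open>The factor is far from optimal; what matters is that it is finite, and \<open>1\<close> for \<open>1 \<times> 1\<close> matrices.\<close>

lemma mat_opnorm_le_entries:
  assumes "finite I" "0 \<le> b" and T: "\<And>i j z. i \<in> I \<Longrightarrow> j \<in> I \<Longrightarrow> norm (T i j z) \<le> b * norm z"
  shows "mat_opnorm I T \<le> ennreal ((real (card I))\<^sup>2 * b)"
proof (rule mat_opnorm_le)
  fix v :: "'a \<Rightarrow> 'b"
  assume v: "L2_set (\<lambda>j. norm (v j)) I \<le> 1"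
  have v1: "norm (v j) \<le> 1" if "j \<in> I" for j
    using member_le_L2_set[OF \<open>finite I\<close> that, of "\<lambda>j. norm (v j)"] v by simp
  have "L2_set (\<lambda>i. norm (\<Sum>j\<in>I. T i j (v j))) I \<le> (\<Sum>i\<in>I. norm (\<Sum>j\<in>I. T i j (v j)))"
    by (rule L2_set_le_sum) auto
  also have "\<dots> \<le> (\<Sum>i\<in>I. \<Sum>j\<in>I. b)"
  proof (intro sum_mono sum_norm_le)
    fix i j assume ij: "i \<in> I" "j \<in> I"
    have "norm (T i j (v j)) \<le> b * norm (v j)"
      using T ij by blast
    also have "\<dots> \<le> b"
      using v1[OF ij(2)] \<open>0 \<le> b\<close> by (simp add: mult_left_le)
    finally show "norm (T i j (v j)) \<le> b" .
  qed
  also have "\<dots> = (real (card I))\<^sup>2 * b"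
    by (simp add: power2_eq_square)
  finally show "ennreal (L2_set (\<lambda>i. norm (\<Sum>j\<in>I. T i j (v j))) I)
      \<le> ennreal ((real (card I))\<^sup>2 * b)"
    by (rule ennreal_leI)
qed

lemma L2_set_Times:
  "L2_set f (I \<times> J) = L2_set (\<lambda>i. L2_set (\<lambda>j. f (i, j)) J) I"
  by (simp add: L2_set_def sum.cartesian_product sum_nonneg)

text \<open>\<open>M\<^sub>m(M\<^sub>k)\<close> and \<open>M\<^sub>k(M\<^sub>m)\<close> are isometric by the shuffle of indices.\<close>

lemma mat_opnorm_swap:
  "mat_opnorm (I \<times> J) T = mat_opnorm (J \<times> I) (\<lambda>a b. T (prod.swap a) (prod.swap b))"
proof -
  have swap: "(\<Sum>a\<in>I \<times> J. g a) = (\<Sum>b\<in>J \<times> I. g (prod.swap b))"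
    for I :: "'x set" and J :: "'y set" and g :: "'x \<times> 'y \<Rightarrow> 'z::comm_monoid_add"
    by (rule sum.reindex_bij_witness[of _ prod.swap prod.swap]) auto
  have le: "mat_opnorm (I \<times> J) T \<le> mat_opnorm (J \<times> I) (\<lambda>a b. T (prod.swap a) (prod.swap b))"
    for I :: "'x set" and J :: "'y set"
      and T :: "'x \<times> 'y \<Rightarrow> 'x \<times> 'y \<Rightarrow> 'v \<Rightarrow> 'v::real_normed_vector"
  proof (rule mat_opnorm_le)
    fix v :: "'x \<times> 'y \<Rightarrow> 'v"
    assume v: "L2_set (\<lambda>j. norm (v j)) (I \<times> J) \<le> 1"
    then have "L2_set (\<lambda>j. norm (v (prod.swap j))) (J \<times> I) \<le> 1"
      unfolding L2_set_def swap[of _ I J] .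
    from mat_opnorm_ge[OF this, of "\<lambda>a b. T (prod.swap a) (prod.swap b)"]
    show "ennreal (L2_set (\<lambda>i. norm (\<Sum>j\<in>I \<times> J. T i j (v j))) (I \<times> J))
        \<le> mat_opnorm (J \<times> I) (\<lambda>a b. T (prod.swap a) (prod.swap b))"
      unfolding L2_set_def swap[of _ I J] .
  qed
  show ?thesis
    by (rule antisym[OF le]) (use le[of J I "\<lambda>a b. T (prod.swap a) (prod.swap b)"] in simp)
qed

lemma op_mat_norm_finite: "op_mat_norm n A < top"
proof -
  let ?b = "\<Sum>i<n. \<Sum>j<n. norm (A i j)"
  have "norm (A i j) \<le> ?b" if "i < n" "j < n" for i j
    using that by (auto intro!: order_trans[OF member_le_sum[of j "{..<n}" "\<lambda>j. norm (A i j)"]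
        member_le_sum[of i "{..<n}" "\<lambda>i. \<Sum>j<n. norm (A i j)"]] sum_nonneg)
  then have "norm (blinfun_apply (A i j) z) \<le> ?b * norm z" if "i < n" "j < n" for i j z
    using that by (blast intro: order_trans[OF norm_blinfun] mult_right_mono norm_ge_zero)
  then have "op_mat_norm n A \<le> ennreal ((real (card {..<n}))\<^sup>2 * ?b)"
    unfolding op_mat_norm_def by (intro mat_opnorm_le_entries) (auto intro!: sum_nonneg)
  then show ?thesis
    by (rule le_less_trans) simp
qed

text \<open>An entry is the restriction of the matrix to one summand, followed by a projection.\<close>

lemma norm_entry_le:
  assumes A: "op_mat_norm n A \<le> ennreal r" and "0 \<le> r" and ij: "i < n" "j < n"
  shows "norm (A i j) \<le> r"
proof (rule norm_blinfun_bound[OF \<open>0 \<le> r\<close>])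
  have unit: "norm (blinfun_apply (A i j) u) \<le> r" if "norm u \<le> 1" for u
  proof -
    define v where "v = (\<lambda>q. if q = j then u else 0)"
    have "L2_set (\<lambda>q. norm (v q)) {..<n} = norm u"
      using ij by (simp add: v_def L2_set_def if_distrib[of norm] if_distrib[of "\<lambda>x. x\<^sup>2"]
          cong: if_cong)
    then have "ennreal (L2_set (\<lambda>p. norm (\<Sum>q<n. blinfun_apply (A p q) (v q))) {..<n})
        \<le> ennreal r"
      using mat_opnorm_ge[of v "{..<n}" "\<lambda>i j. blinfun_apply (A i j)"] that A
      unfolding op_mat_norm_def by (auto intro: order_trans)
    then have "L2_set (\<lambda>p. norm (\<Sum>q<n. blinfun_apply (A p q) (v q))) {..<n} \<le> r"
      using \<open>0 \<le> r\<close> by simp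
    moreover have "norm (\<Sum>q<n. blinfun_apply (A i q) (v q))
        \<le> L2_set (\<lambda>p. norm (\<Sum>q<n. blinfun_apply (A p q) (v q))) {..<n}"
      using ij by (intro member_le_L2_set) auto
    moreover have "(\<Sum>q<n. blinfun_apply (A i q) (v q)) = blinfun_apply (A i j) u"
      using ij by (simp add: v_def if_distrib[of "blinfun_apply _"] blinfun.zero_right cong: if_cong)
    ultimately show ?thesis
      by simp
  qed
  fix x
  show "norm (blinfun_apply (A i j) x) \<le> r * norm x"
  proof (cases "x = 0")
    case False
    then show ?thesis
      using unit[of "(1 / norm x) *\<^sub>R x"]
      by (simp add: blinfun.scaleR_right field_simps)
  qed (simp add: blinfun.zero_right)
qed

section \<open>Orthonormal systems\<close>

lemma scaleC_zero_left [simp]: "(0::complex) *\<^sub>C x = (0::'h::complex_hilbert_space)"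
  using scaleC_of_real[of 0 x] by simp

lemma scaleC_one [simp]: "(1::complex) *\<^sub>C x = (x::'h::complex_hilbert_space)"
  using scaleC_of_real[of 1 x] by simp

lemma scaleC_diff_right:
  "c *\<^sub>C (x - y) = c *\<^sub>C x - c *\<^sub>C (y::'h::complex_hilbert_space)"
  using scaleC_add_right[of c "x - y" y] by simp

lemma cinner_zero_left [simp]: "cinner 0 (x::'h::complex_hilbert_space) = 0"
  using cinner_add_left[of 0 0 x] by simp

lemma cinner_diff_left: "cinner (x - y) z = cinner x z - cinner y (z::'h::complex_hilbert_space)"
  using cinner_add_left[of "x - y" y z] by simp

lemma cinner_diff_right: "cinner z (x - y) = cinner z x - cinner z (y::'h::complex_hilbert_space)"
  using cinner_diff_left[of x y z] by (metis cinner_commute complex_cnj_diff)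

lemma cinner_sum_left:
  "cinner (\<Sum>i\<in>I. f i) (z::'h::complex_hilbert_space) = (\<Sum>i\<in>I. cinner (f i) z)"
  by (induction I rule: infinite_finite_induct) (auto simp: cinner_add_left)

lemma cinner_sum_right:
  "cinner (z::'h::complex_hilbert_space) (\<Sum>i\<in>I. f i) = (\<Sum>i\<in>I. cinner z (f i))"
  by (subst cinner_commute) (simp add: cinner_sum_left cinner_commute[of z])

lemma cinner_scaleC_right:
  "cinner z (a *\<^sub>C x) = cnj a * cinner z (x::'h::complex_hilbert_space)"
  by (subst cinner_commute) (simp add: cinner_scaleC_left cinner_commute[of z])

definition orthonormal :: "nat \<Rightarrow> (nat \<Rightarrow> 'h::complex_hilbert_space) \<Rightarrow> bool"
  where "orthonormal k e \<longleftrightarrow> (\<forall>i<k. \<forall>j<k. cinner (e i) (e j) = (if i = j then 1 else 0))"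

lemma cinner_orthonormal_sum:
  assumes "orthonormal k e" "j < k"
  shows "cinner (\<Sum>i<k. c i *\<^sub>C e i) (e j) = c j"
proof -
  have "cinner (\<Sum>i<k. c i *\<^sub>C e i) (e j) = (\<Sum>i<k. if i = j then c i else 0)"
    unfolding cinner_sum_left cinner_scaleC_left
    by (rule sum.cong) (use assms in \<open>auto simp: orthonormal_def\<close>)
  then show ?thesis
    using assms by simp
qed

lemma L2_set_orthonormal_sum:
  assumes "orthonormal k e"
  shows "L2_set (\<lambda>i. cmod (c i)) {..<k} = norm (\<Sum>i<k. c i *\<^sub>C e i)"
proof -
  let ?s = "\<Sum>i<k. c i *\<^sub>C e i"
  have "complex_of_real ((norm ?s)\<^sup>2) = (\<Sum>i<k. cnj (c i) * cinner ?s (e i))"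
    unfolding cinner_self[symmetric]
    by (simp only: cinner_sum_right cinner_scaleC_right)
  also have "\<dots> = complex_of_real (\<Sum>i<k. (cmod (c i))\<^sup>2)"
    using cinner_orthonormal_sum[OF assms] by (simp add: complex_norm_square mult.commute del: of_real_power)
  finally have "(norm ?s)\<^sup>2 = (\<Sum>i<k. (cmod (c i))\<^sup>2)"
    using of_real_eq_iff by blast
  then show ?thesis
    by (simp add: L2_set_def flip: \<open>(norm ?s)\<^sup>2 = _\<close>)
qed

text \<open>The projection \<open>s\<close> of \<open>x\<close> satisfies \<open>\<parallel>x - s\<parallel>\<^sup>2 = \<parallel>x\<parallel>\<^sup>2 - \<parallel>s\<parallel>\<^sup>2\<close>.\<close>

lemma Bessel:
  assumes "orthonormal k e"
  shows "L2_set (\<lambda>i. cmod (cinner x (e i))) {..<k} \<le> norm x"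
proof -
  let ?s = "\<Sum>i<k. cinner x (e i) *\<^sub>C e i"
  have s: "(norm ?s)\<^sup>2 = (\<Sum>i<k. (cmod (cinner x (e i)))\<^sup>2)"
    unfolding L2_set_orthonormal_sum[OF assms, symmetric]
    by (simp add: L2_set_def sum_nonneg)
  have xs: "cinner x ?s = complex_of_real ((norm ?s)\<^sup>2)"
    unfolding s by (simp add: cinner_sum_right cinner_scaleC_right complex_norm_square mult.commute
        del: of_real_power)
  have sx: "cinner ?s x = complex_of_real ((norm ?s)\<^sup>2)"
    by (subst cinner_commute) (simp only: xs complex_cnj_complex_of_real)
  have "cinner (x - ?s) (x - ?s) = cinner x x - cinner ?s ?s"
    by (simp only: cinner_diff_left cinner_diff_right xs sx) (simp add: cinner_self)
  then have "complex_of_real ((norm (x - ?s))\<^sup>2) = complex_of_real ((norm x)\<^sup>2 - (norm ?s)\<^sup>2)"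
    by (simp only: cinner_self of_real_diff)
  then have "(norm (x - ?s))\<^sup>2 = (norm x)\<^sup>2 - (norm ?s)\<^sup>2"
    using of_real_eq_iff by blast
  then have "(norm ?s)\<^sup>2 \<le> (norm x)\<^sup>2"
    using zero_le_power2[of "norm (x - ?s)"] by linarith
  then have "norm ?s \<le> norm x"
    by (rule power2_le_imp_le) simp
  then show ?thesis
    unfolding L2_set_orthonormal_sum[OF assms] .
qed

lemma cmod_cinner_orthonormal_le:
  assumes "orthonormal k e" "i < k"
  shows "cmod (cinner x (e i)) \<le> norm x"
  using member_le_L2_set[of "{..<k}" i "\<lambda>i. cmod (cinner x (e i))"] Bessel[OF assms(1), of x] assms(2)
  by simp

text \<open>The induction yields some coefficients for each vector of \<open>S\<close>; orthonormality then identifies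
  them with the inner products.\<close>

lemma Gram_Schmidt:
  fixes S :: "'h::complex_hilbert_space set"
  assumes "finite S"
  shows "\<exists>k e. orthonormal k e \<and> (\<forall>s\<in>S. s = (\<Sum>i<k. cinner s (e i) *\<^sub>C e i))"
proof -
  have "\<exists>k e. orthonormal k e \<and> (\<forall>s\<in>S. \<exists>c. s = (\<Sum>i<k. c i *\<^sub>C e i))"
    using assms
  proof induction
    case empty
    show ?case
      by (rule exI[of _ 0]) (simp add: orthonormal_def)
  next
    case (insert s S)
    from insert.IH obtain k e where e: "orthonormal k e"
      and S: "\<forall>s\<in>S. \<exists>c. s = (\<Sum>i<k. c i *\<^sub>C e i)"
      by (elim exE conjE)
    define p where "p = (\<Sum>i<k. cinner s (e i) *\<^sub>C e i)"
    show ?case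
    proof (cases "s = p")
      case True
      then have "\<exists>c. s = (\<Sum>i<k. c i *\<^sub>C e i)"
        unfolding p_def by (rule exI[of _ "\<lambda>i. cinner s (e i)"])
      with e S show ?thesis
        by (intro exI[of _ k] exI[of _ e] conjI ballI) (auto elim!: insertE)
    next
      case False
      define r where "r = complex_of_real (norm (s - p))"
      have r: "r \<noteq> 0" "cnj r = r"
        using False by (auto simp: r_def)
      define e' where "e' = e(k := (1 / r) *\<^sub>C (s - p))"
      have orth: "cinner (e' k) (e i) = 0" if "i < k" for i
        using cinner_orthonormal_sum[OF e that, of "\<lambda>i. cinner s (e i)"]
        by (simp add: e'_def cinner_scaleC_left cinner_diff_left p_def)
      have "cinner (e' k) (e' k) = 1 / r * (cnj (1 / r) * cinner (s - p) (s - p))"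
        by (simp only: e'_def fun_upd_same cinner_scaleC_left cinner_scaleC_right
            mult.left_commute)
      then have "cinner (e' k) (e' k) = 1"
        using r by (simp only: cinner_self) (simp add: r_def power2_eq_square)
      moreover have "cinner (e i) (e' k) = 0" if "i < k" for i
        using orth[OF that] cinner_commute[of "e i" "e' k"] by simp
      ultimately have "orthonormal (Suc k) e'"
        using e orth by (auto simp: orthonormal_def less_Suc_eq e'_def)
      moreover have "\<exists>c. t = (\<Sum>i<Suc k. c i *\<^sub>C e' i)" if "t \<in> S" for t
      proof -
        obtain c where "t = (\<Sum>i<k. c i *\<^sub>C e i)"
          using bspec[OF S \<open>t \<in> S\<close>] by (elim exE)
        then have "t = (\<Sum>i<Suc k. (c(k := 0)) i *\<^sub>C e' i)"
          by (simp add: e'_def)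
        then show ?thesis
          by (rule exI[of _ "c(k := 0)"])
      qed
      moreover have "s = (\<Sum>i<Suc k. (if i < k then cinner s (e i) else r) *\<^sub>C e' i)"
        using r by (simp add: e'_def scaleC_scaleC flip: p_def)
      then have "\<exists>c. s = (\<Sum>i<Suc k. c i *\<^sub>C e' i)"
        by (rule exI[of _ "\<lambda>i. if i < k then cinner s (e i) else r"])
      ultimately show ?thesis
        by (intro exI[of _ "Suc k"] exI[of _ e'] conjI ballI) (auto simp del: sum.lessThan_Suc)
    qed
  qed
  then obtain k e where e: "orthonormal k e"
    and S: "\<forall>s\<in>S. \<exists>c. s = (\<Sum>i<k. c i *\<^sub>C e i)"
    by (elim exE conjE)
  have "s = (\<Sum>i<k. cinner s (e i) *\<^sub>C e i)" if "s \<in> S" for s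
  proof -
    obtain c where c: "s = (\<Sum>i<k. c i *\<^sub>C e i)"
      using bspec[OF S \<open>s \<in> S\<close>] by (elim exE)
    then have "cinner s (e i) = c i" if "i < k" for i
      using cinner_orthonormal_sum[OF e that, of c] by simp
    then have "(\<Sum>i<k. cinner s (e i) *\<^sub>C e i) = (\<Sum>i<k. c i *\<^sub>C e i)"
      by (intro sum.cong) auto
    with c show ?thesis
      by simp
  qed
  with e show ?thesis
    by (intro exI conjI ballI)
qed

section \<open>Matrix norms and amplifications\<close>

text \<open>The common part of the spaces at hand that makes it possible to pass from unit balls, over which
  cb-norms are defined, to arbitrary matrices by scaling.\<close>

locale matrix_homogeneous =
  fixes E :: "'c mat_normed_space"
  assumes scale_closed: "f \<in> carr E \<Longrightarrow> (\<lambda>x. c * f x) \<in> carr E"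
    and mnorm_cong: "(\<And>i j. i < k \<Longrightarrow> j < k \<Longrightarrow> A i j = B i j) \<Longrightarrow> mnorm E k A = mnorm E k B"
    and mnorm_scale: "A \<in> mats k (carr E) \<Longrightarrow>
      mnorm E k (\<lambda>i j x. c * A i j x) \<le> ennreal (cmod c) * mnorm E k A"

lemma mnorm_le_cb_norm:
  assumes "k \<ge> 1" "A \<in> mats k (carr E)" "mnorm E k A \<le> 1"
  shows "mnorm F k (\<lambda>i j. u (A i j)) \<le> cb_norm E F u"
proof -
  have "mnorm F k (\<lambda>i j. u (A i j)) \<le> amp_norm E F u k"
    unfolding amp_norm_def by (rule SUP_upper) (use assms in auto)
  also have "\<dots> \<le> cb_norm E F u"
    unfolding cb_norm_def by (rule SUP_upper) (use assms in auto)
  finally show ?thesis .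
qed

text \<open>The bound \<open>c\<close> on the norm of \<open>A\<close> is required to be positive so that \<open>A\<close> can be divided by it;
  a matrix of norm zero is covered by all small \<open>c\<close>.\<close>

lemma mnorm_amp_le_cb_norm:
  assumes "matrix_homogeneous E" "matrix_homogeneous F"
    and maps: "\<And>f. f \<in> carr E \<Longrightarrow> u f \<in> carr F"
    and hom: "\<And>c f. f \<in> carr E \<Longrightarrow> u (\<lambda>x. c * f x) = (\<lambda>x. c * u f x)"
    and "k \<ge> 1" and A: "A \<in> mats k (carr E)" "mnorm E k A \<le> ennreal c" and "0 < c"
  shows "mnorm F k (\<lambda>i j. u (A i j)) \<le> ennreal c * cb_norm E F u"
proof -
  interpret E: matrix_homogeneous E by fact
  interpret F: matrix_homogeneous F by fact
  define A' where "A' = (\<lambda>i j x. complex_of_real (1 / c) * A i j x)"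
  have A': "A' \<in> mats k (carr E)"
    using A(1) unfolding mats_def A'_def by (blast intro: E.scale_closed)
  have "mnorm E k A' \<le> ennreal (cmod (complex_of_real (1 / c))) * mnorm E k A"
    unfolding A'_def by (rule E.mnorm_scale[OF A(1)])
  also have "\<dots> \<le> ennreal (1 / c) * ennreal c"
    using \<open>0 < c\<close> A(2) by (intro mult_mono) (auto simp: norm_divide)
  also have "\<dots> = 1"
    using \<open>0 < c\<close> by (simp flip: ennreal_mult)
  finally have A'1: "mnorm E k A' \<le> 1" .
  have "A i j = (\<lambda>x. complex_of_real c * A' i j x)" for i j
    using \<open>0 < c\<close> by (auto simp: A'_def fun_eq_iff simp flip: of_real_mult mult.assoc)
  then have "u (A i j) = (\<lambda>x. complex_of_real c * u (A' i j) x)" if "i < k" "j < k" for i j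
    using hom[of "A' i j"] A' that by (simp add: mats_def)
  then have "mnorm F k (\<lambda>i j. u (A i j)) = mnorm F k (\<lambda>i j x. complex_of_real c * u (A' i j) x)"
    by (rule F.mnorm_cong)
  also have "\<dots> \<le> ennreal c * mnorm F k (\<lambda>i j. u (A' i j))"
    using F.mnorm_scale[of "\<lambda>i j. u (A' i j)" k "complex_of_real c"] A' maps \<open>0 < c\<close>
    by (auto simp: mats_def)
  also have "\<dots> \<le> ennreal c * cb_norm E F u"
    by (intro mult_left_mono mnorm_le_cb_norm \<open>k \<ge> 1\<close> A' A'1) simp
  finally show ?thesis .
qed

lemma cb_norm_le:
  assumes "\<And>k A. k \<ge> 1 \<Longrightarrow> A \<in> mats k (carr E) \<Longrightarrow> mnorm E k A \<le> 1 \<Longrightarrow>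
    mnorm F k (\<lambda>i j. u (A i j)) \<le> b"
  shows "cb_norm E F u \<le> b"
  unfolding cb_norm_def amp_norm_def using assms by (auto intro!: SUP_least)

lemma mnorm_scalar_mats:
  "mnorm (scalar_mats k) m A =
    mat_opnorm ({..<m} \<times> {..<k}) (\<lambda>a b z. A (fst a) (fst b) (snd a, snd b) * z)"
  by (simp add: scalar_mats_def) (rule mat_opnorm_cong, auto)

lemma matrix_homogeneous_scalar_mats: "matrix_homogeneous (scalar_mats k)"
proof
  fix A :: "nat \<Rightarrow> nat \<Rightarrow> nat \<times> nat \<Rightarrow> complex" and c m
  show "mnorm (scalar_mats k) m (\<lambda>i j x. c * A i j x)
      \<le> ennreal (cmod c) * mnorm (scalar_mats k) m A"
    unfolding mnorm_scalar_mats mult.assoc by (rule mat_opnorm_scale)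
next
  fix A B :: "nat \<Rightarrow> nat \<Rightarrow> nat \<times> nat \<Rightarrow> complex" and m
  assume "\<And>i j. i < m \<Longrightarrow> j < m \<Longrightarrow> A i j = B i j"
  then show "mnorm (scalar_mats k) m A = mnorm (scalar_mats k) m B"
    unfolding mnorm_scalar_mats by (intro mat_opnorm_cong) auto
qed (auto simp: scalar_mats_def)

lemmas mnorm_scalar_mats_cong = matrix_homogeneous.mnorm_cong[OF matrix_homogeneous_scalar_mats]

lemma mnorm_scalar_mats_add:
  "mnorm (scalar_mats k) m (\<lambda>p q x. A p q x + B p q x)
    \<le> mnorm (scalar_mats k) m A + mnorm (scalar_mats k) m B"
  unfolding mnorm_scalar_mats distrib_right by (rule mat_opnorm_add)

lemma mnorm_scalar_mats_le:
  assumes "0 \<le> b" "\<And>p q i j. p < m \<Longrightarrow> q < m \<Longrightarrow> i < k \<Longrightarrow> j < k \<Longrightarrow> cmod (A p q (i, j)) \<le> b"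
  shows "mnorm (scalar_mats k) m A \<le> ennreal ((real (m * k))\<^sup>2 * b)"
proof -
  have "mnorm (scalar_mats k) m A \<le> ennreal ((real (card ({..<m} \<times> {..<k})))\<^sup>2 * b)"
    unfolding mnorm_scalar_mats using assms
    by (intro mat_opnorm_le_entries) (auto simp: norm_mult intro!: mult_right_mono)
  then show ?thesis
    by (simp add: card_cartesian_product)
qed

lemma cmod_entry_le_mnorm_scalar_mats:
  assumes "0 < m" "0 < k"
  shows "ennreal (cmod (A 0 0 (0, 0))) \<le> mnorm (scalar_mats k) m A"
proof -
  let ?I = "{..<m} \<times> {..<k}" and ?T = "\<lambda>a b z. A (fst a) (fst b) (snd a, snd b) * z"
  define v :: "nat \<times> nat \<Rightarrow> complex" where "v = (\<lambda>b. if b = (0, 0) then 1 else 0)"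
  have "L2_set (\<lambda>b. norm (v b)) ?I \<le> 1"
    using assms by (simp add: v_def L2_set_def if_distrib[of norm] if_distrib[of "\<lambda>x. x\<^sup>2"]
        cong: if_cong)
  then have "ennreal (L2_set (\<lambda>a. norm (\<Sum>b\<in>?I. ?T a b (v b))) ?I) \<le> mnorm (scalar_mats k) m A"
    unfolding mnorm_scalar_mats by (rule mat_opnorm_ge)
  moreover have "(\<Sum>b\<in>?I. ?T (0, 0) b (v b)) = A 0 0 (0, 0)"
    using assms by (simp add: v_def if_distrib[of "\<lambda>x. _ * x"] cong: if_cong)
  then have "norm (A 0 0 (0, 0)) \<le> L2_set (\<lambda>a. norm (\<Sum>b\<in>?I. ?T a b (v b))) ?I"
    using assms member_le_L2_set[of ?I "(0, 0)" "\<lambda>a. norm (\<Sum>b\<in>?I. ?T a b (v b))"] by simp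
  ultimately show ?thesis
    by (meson ennreal_leI order_trans)
qed

lemma mnorm_scalar_mats_1: "mnorm (scalar_mats 1) 1 A = ennreal (cmod (A 0 0 (0, 0)))"
proof (rule antisym)
  show "mnorm (scalar_mats 1) 1 A \<le> ennreal (cmod (A 0 0 (0, 0)))"
    using mnorm_scalar_mats_le[of "cmod (A 0 0 (0, 0))" 1 1 A] by simp
qed (simp add: cmod_entry_le_mnorm_scalar_mats)

section \<open>Lipschitz constants of amplifications\<close>

lemma lip_amp_le:
  assumes "\<And>A B. A \<in> mats n X \<Longrightarrow> B \<in> mats n X \<Longrightarrow>
    \<nu> (\<lambda>i j. f (A i j) - f (B i j)) \<le> C * op_mat_norm n (\<lambda>i j. A i j - B i j)"
  shows "lip_amp n X \<nu> f \<le> C"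
  unfolding lip_amp_def by (rule Inf_lower) (use assms in auto)

text \<open>The infimum that defines the Lipschitz constant is attained. If the distance is positive, one
  can divide by it; if it is zero, any admissible constant forces the left-hand side to vanish, and
  finiteness of the infimum provides one.\<close>

lemma lip_amp_apply:
  assumes fin: "lip_amp n X \<nu> f < top" and A: "A \<in> mats n X" and B: "B \<in> mats n X"
  shows "\<nu> (\<lambda>i j. f (A i j) - f (B i j)) \<le> lip_amp n X \<nu> f * op_mat_norm n (\<lambda>i j. A i j - B i j)"
proof -
  let ?S = "{C. \<forall>A\<in>mats n X. \<forall>B\<in>mats n X.
    \<nu> (\<lambda>i j. f (A i j) - f (B i j)) \<le> C * op_mat_norm n (\<lambda>i j. A i j - B i j)}"
  let ?l = "\<nu> (\<lambda>i j. f (A i j) - f (B i j))" and ?d = "op_mat_norm n (\<lambda>i j. A i j - B i j)"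
  have le: "?l \<le> C * ?d" if "C \<in> ?S" for C
    using that A B by blast
  have "?S \<noteq> {}"
  proof
    assume "?S = {}"
    then have "lip_amp n X \<nu> f = top"
      unfolding lip_amp_def by (simp only: Inf_empty)
    with fin show False
      by simp
  qed
  show ?thesis
  proof (cases "?d = 0")
    case True
    then show ?thesis
      using le \<open>?S \<noteq> {}\<close> by fastforce
  next
    case False
    have d: "?d < top"
      by (rule op_mat_norm_finite)
    have "?l / ?d \<le> lip_amp n X \<nu> f"
      unfolding lip_amp_def
    proof (rule Inf_greatest)
      fix C assume "C \<in> ?S"
      then have "?l / ?d \<le> C * ?d / ?d"
        by (intro divide_right_mono_ennreal le)
      also have "C * ?d / ?d = C"
        using False d by (intro ennreal_mult_divide_eq) auto
      finally show "?l / ?d \<le> C" .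
    qed
    then have "?l / ?d * ?d \<le> lip_amp n X \<nu> f * ?d"
      by (rule mult_right_mono) simp
    then show ?thesis
      using False d by (simp add: ennreal_divide_times)
  qed
qed

text \<open>A Lipschitz function has finite Lipschitz constants on all amplifications, because entries are
  dominated by the norm of the matrix and, up to a factor depending on its size, dominate it.\<close>

lemma lip_amp_finite:
  assumes "0 \<le> K" and K: "\<And>A B r. A \<in> mats n X \<Longrightarrow> B \<in> mats n X \<Longrightarrow> 0 \<le> r \<Longrightarrow>
    (\<And>i j. i < n \<Longrightarrow> j < n \<Longrightarrow> norm (A i j - B i j) \<le> r) \<Longrightarrow>
    \<nu> (\<lambda>i j. f (A i j) - f (B i j)) \<le> ennreal (K * r)"
  shows "lip_amp n X \<nu> f < top"
proof -
  have "lip_amp n X \<nu> f \<le> ennreal K"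
  proof (rule lip_amp_le)
    fix A B assume A: "A \<in> mats n X" and B: "B \<in> mats n X"
    obtain r where r: "0 \<le> r" "op_mat_norm n (\<lambda>i j. A i j - B i j) = ennreal r"
      using op_mat_norm_finite[of n "\<lambda>i j. A i j - B i j"]
      by (cases "op_mat_norm n (\<lambda>i j. A i j - B i j)") auto
    then have "norm (A i j - B i j) \<le> r" if "i < n" "j < n" for i j
      using norm_entry_le[of n "\<lambda>i j. A i j - B i j" r i j] that by simp
    then show "\<nu> (\<lambda>i j. f (A i j) - f (B i j)) \<le> ennreal K * op_mat_norm n (\<lambda>i j. A i j - B i j)"
      using K[OF A B r(1)] r \<open>0 \<le> K\<close> by (simp add: ennreal_mult)
  qed
  then show ?thesis
    by (rule le_less_trans) simp
qed

lemma Lip_n_finite: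
  assumes L: "C-lipschitz_on X L"
  shows "Lip_n n X L < top"
proof (rule lip_amp_finite[of "(real n)\<^sup>2 * C"])
  have C: "0 \<le> C"
    using L by (rule lipschitz_on_nonneg)
  then show "0 \<le> (real n)\<^sup>2 * C"
    by simp
  fix A B r
  assume AB: "A \<in> mats n X" "B \<in> mats n X" and "0 \<le> r"
    and r: "\<And>i j. i < n \<Longrightarrow> j < n \<Longrightarrow> norm (A i j - B i j) \<le> r"
  have "norm (L (A i j) - L (B i j)) \<le> C * r" if "i < n" "j < n" for i j
  proof -
    have "norm (L (A i j) - L (B i j)) \<le> C * norm (A i j - B i j)"
      using lipschitz_onD[OF L, of "A i j" "B i j"] AB that by (simp add: mats_def dist_norm)
    also have "\<dots> \<le> C * r"
      using r that C by (intro mult_left_mono) auto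
    finally show ?thesis .
  qed
  then have "norm (blinfun_apply (L (A i j) - L (B i j)) z) \<le> C * r * norm z"
    if "i < n" "j < n" for i j z
    using that by (blast intro: order_trans[OF norm_blinfun] mult_right_mono norm_ge_zero)
  then have "op_mat_norm n (\<lambda>i j. L (A i j) - L (B i j)) \<le> ennreal ((real (card {..<n}))\<^sup>2 * (C * r))"
    unfolding op_mat_norm_def using C \<open>0 \<le> r\<close> by (intro mat_opnorm_le_entries) auto
  then show "op_mat_norm n (\<lambda>i j. L (A i j) - L (B i j)) \<le> ennreal ((real n)\<^sup>2 * C * r)"
    by (simp add: mult.assoc)
qed

lemma carr_Lip0_space:
  "carr (Lip0_space n X x0)
    = {f. f x0 = 0 \<and> (\<exists>C. C-lipschitz_on X f) \<and> (\<forall>x. x \<notin> X \<longrightarrow> f x = 0)}"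
  by (simp add: Lip0_space_def)

lemma mnorm_Lip0_space:
  "mnorm (Lip0_space n X x0) k f = lip_amp n X (mnorm (scalar_mats k) n) (mat_fun k f)"
  by (simp add: Lip0_space_def)

lemma mnorm_Lip0_space_finite:
  assumes f: "f \<in> mats k (carr (Lip0_space n X x0))"
  shows "mnorm (Lip0_space n X x0) k f < top"
proof -
  have "\<exists>C. C-lipschitz_on X (f i j)" if "i < k" "j < k" for i j
    using f that by (auto simp: mats_def carr_Lip0_space)
  then obtain C where C: "\<And>i j. i < k \<Longrightarrow> j < k \<Longrightarrow> (C i j)-lipschitz_on X (f i j)"
    by metis
  define K where "K = (\<Sum>i<k. \<Sum>j<k. \<bar>C i j\<bar>)"
  have "C i j \<le> K" if "i < k" "j < k" for i j
  proof -
    have "\<bar>C i j\<bar> \<le> (\<Sum>j<k. \<bar>C i j\<bar>)"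
      using that by (intro member_le_sum) auto
    also have "\<dots> \<le> K"
      unfolding K_def using that
      by (intro member_le_sum[of i _ "\<lambda>i. \<Sum>j<k. \<bar>C i j\<bar>"]) (auto intro: sum_nonneg)
    finally show ?thesis
      by simp
  qed
  then have K: "K-lipschitz_on X (f i j)" if "i < k" "j < k" for i j
    using C that by (blast intro: lipschitz_on_le)
  have "0 \<le> K"
    by (auto simp: K_def intro: sum_nonneg)
  show ?thesis
    unfolding mnorm_Lip0_space
  proof (rule lip_amp_finite[of "(real (n * k))\<^sup>2 * K"])
    show "0 \<le> (real (n * k))\<^sup>2 * K"
      using \<open>0 \<le> K\<close> by simp
    fix A B r
    assume AB: "A \<in> mats n X" "B \<in> mats n X" and "0 \<le> r"
      and r: "\<And>i j. i < n \<Longrightarrow> j < n \<Longrightarrow> norm (A i j - B i j) \<le> r"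
    have "cmod (f i j (A p q) - f i j (B p q)) \<le> K * r" if "p < n" "q < n" "i < k" "j < k" for p q i j
    proof -
      have "cmod (f i j (A p q) - f i j (B p q)) \<le> K * norm (A p q - B p q)"
        using lipschitz_onD[OF K, of i j "A p q" "B p q"] AB that by (simp add: mats_def dist_norm)
      also have "\<dots> \<le> K * r"
        using r that \<open>0 \<le> K\<close> by (intro mult_left_mono) auto
      finally show ?thesis .
    qed
    then show "mnorm (scalar_mats k) n (\<lambda>i j. mat_fun k f (A i j) - mat_fun k f (B i j))
        \<le> ennreal ((real (n * k))\<^sup>2 * K * r)"
      unfolding mult.assoc using \<open>0 \<le> K\<close> \<open>0 \<le> r\<close>
      by (intro mnorm_scalar_mats_le) (auto simp: mat_fun_def)
  qed
qed

lemma Lip0_space_apply: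
  assumes "f \<in> mats k (carr (Lip0_space n X x0))" "A \<in> mats n X" "B \<in> mats n X"
  shows "mnorm (scalar_mats k) n (\<lambda>p q. mat_fun k f (A p q) - mat_fun k f (B p q))
    \<le> mnorm (Lip0_space n X x0) k f * op_mat_norm n (\<lambda>p q. A p q - B p q)"
  using lip_amp_apply[OF mnorm_Lip0_space_finite[OF assms(1), unfolded mnorm_Lip0_space] assms(2,3)]
  unfolding mnorm_Lip0_space .

lemma matrix_homogeneous_Lip0_space: "matrix_homogeneous (Lip0_space n X x0)"
proof
  fix f c
  assume f: "f \<in> carr (Lip0_space n X x0)"
  then obtain C where "C-lipschitz_on X f"
    by (auto simp: carr_Lip0_space)
  then have "(cmod c * C)-lipschitz_on X (\<lambda>x. c * f x)"
    by (auto simp: lipschitz_on_def dist_norm norm_mult mult.assoc mult_left_mono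
        simp flip: right_diff_distrib)
  with f show "(\<lambda>x. c * f x) \<in> carr (Lip0_space n X x0)"
    by (auto simp: carr_Lip0_space)
next
  fix k and A B :: "nat \<Rightarrow> nat \<Rightarrow> ('a \<Rightarrow>\<^sub>L 'a) \<Rightarrow> complex"
  assume "\<And>i j. i < k \<Longrightarrow> j < k \<Longrightarrow> A i j = B i j"
  then have "mat_fun k A = mat_fun k B"
    by (auto simp: mat_fun_def fun_eq_iff)
  then show "mnorm (Lip0_space n X x0) k A = mnorm (Lip0_space n X x0) k B"
    unfolding mnorm_Lip0_space by simp
next
  fix k c and f :: "nat \<Rightarrow> nat \<Rightarrow> ('a \<Rightarrow>\<^sub>L 'a) \<Rightarrow> complex"
  assume f: "f \<in> mats k (carr (Lip0_space n X x0))"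
  interpret S: matrix_homogeneous "scalar_mats k"
    by (rule matrix_homogeneous_scalar_mats)
  show "mnorm (Lip0_space n X x0) k (\<lambda>i j x. c * f i j x)
      \<le> ennreal (cmod c) * mnorm (Lip0_space n X x0) k f"
    unfolding mnorm_Lip0_space[of _ _ _ _ "\<lambda>i j x. c * f i j x"]
  proof (rule lip_amp_le)
    fix A B assume AB: "A \<in> mats n X" "B \<in> mats n X"
    let ?M = "\<lambda>p q. mat_fun k f (A p q) - mat_fun k f (B p q)"
    have "mnorm (scalar_mats k) n (\<lambda>p q. mat_fun k (\<lambda>i j x. c * f i j x) (A p q)
            - mat_fun k (\<lambda>i j x. c * f i j x) (B p q))
        = mnorm (scalar_mats k) n (\<lambda>p q x. c * ?M p q x)"
      by (rule S.mnorm_cong) (auto simp: mat_fun_def fun_eq_iff algebra_simps)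
    also have "\<dots> \<le> ennreal (cmod c) * mnorm (scalar_mats k) n ?M"
      by (rule S.mnorm_scale) (auto simp: mats_def scalar_mats_def mat_fun_def)
    also have "\<dots> \<le> ennreal (cmod c) *
        (mnorm (Lip0_space n X x0) k f * op_mat_norm n (\<lambda>p q. A p q - B p q))"
      by (intro mult_left_mono Lip0_space_apply f AB) simp
    finally show "mnorm (scalar_mats k) n (\<lambda>p q. mat_fun k (\<lambda>i j x. c * f i j x) (A p q)
            - mat_fun k (\<lambda>i j x. c * f i j x) (B p q))
        \<le> ennreal (cmod c) * mnorm (Lip0_space n X x0) k f * op_mat_norm n (\<lambda>p q. A p q - B p q)"
      by (simp add: mult.assoc)
  qed
qed

section \<open>Compressions to finite-dimensional subspaces\<close>

text \<open>The matrix coefficients of \<open>y - y\<^sub>0\<close>, extended by zero off \<open>Y\<close>. Subtracting \<open>y\<^sub>0\<close> makes them vanish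
  at the base point and cancels in differences.\<close>

definition compression :: "('h::complex_hilbert_space \<Rightarrow>\<^sub>L 'h) set \<Rightarrow> ('h \<Rightarrow>\<^sub>L 'h) \<Rightarrow>
    (nat \<Rightarrow> 'h) \<Rightarrow> nat \<Rightarrow> nat \<Rightarrow> ('h \<Rightarrow>\<^sub>L 'h) \<Rightarrow> complex"
  where "compression Y y0 e i j y =
    (if y \<in> Y then cinner (blinfun_apply (y - y0) (e j)) (e i) else 0)"

lemma compression_in_mats:
  assumes e: "orthonormal k e" and "y0 \<in> Y"
  shows "compression Y y0 e \<in> mats k (carr (Lip0_space n Y y0))"
proof -
  have "1-lipschitz_on Y (compression Y y0 e i j)" if ij: "i < k" "j < k" for i j
  proof (rule lipschitz_onI)
    fix x y assume "x \<in> Y" "y \<in> Y"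
    have "complex_of_real ((norm (e j))\<^sup>2) = 1"
      using e ij unfolding cinner_self[symmetric] orthonormal_def by simp
    then have "(norm (e j))\<^sup>2 = 1"
      using of_real_eq_1_iff by blast
    then have e1: "norm (e j) = 1"
      by (simp add: power2_eq_1_iff) (use norm_ge_zero[of "e j"] in linarith)
    have "compression Y y0 e i j x - compression Y y0 e i j y = cinner (blinfun_apply (x - y) (e j)) (e i)"
      using \<open>x \<in> Y\<close> \<open>y \<in> Y\<close>
      by (simp add: compression_def blinfun.diff_left cinner_diff_left)
    then have "dist (compression Y y0 e i j x) (compression Y y0 e i j y)
        \<le> norm (blinfun_apply (x - y) (e j))"
      using cmod_cinner_orthonormal_le[OF e ij(1)] by (simp add: dist_norm)
    also have "\<dots> \<le> 1 * dist x y"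
      using norm_blinfun[of "x - y" "e j"] e1 by (simp add: dist_norm)
    finally show "dist (compression Y y0 e i j x) (compression Y y0 e i j y) \<le> 1 * dist x y" .
  qed simp
  then show ?thesis
    using \<open>y0 \<in> Y\<close> by (auto simp: mats_def carr_Lip0_space compression_def)
qed

text \<open>A vector \<open>z\<close> of coefficients stands for the vector of the Hilbert space sum whose \<open>q\<close>-th component
  is \<open>\<Sum>\<^sub>j z\<^sub>q\<^sub>j e\<^sub>j\<close>; complex linearity of the operators moves the coefficients out.\<close>

lemma compression_matrix_apply:
  assumes M: "\<And>q. q < n \<Longrightarrow> M q \<in> bounded_ops"
  shows "(\<Sum>b\<in>{..<n} \<times> {..<k}. cinner (blinfun_apply (M (fst b)) (e (snd b))) w * z b)
    = cinner (\<Sum>q<n. blinfun_apply (M q) (\<Sum>j<k. z (q, j) *\<^sub>C e j)) w"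
proof -
  have "cinner (blinfun_apply (M q) (\<Sum>j<k. z (q, j) *\<^sub>C e j)) w
      = (\<Sum>j<k. cinner (blinfun_apply (M q) (e j)) w * z (q, j))" if "q < n" for q
    using M[OF that]
    by (simp add: blinfun.sum_right bounded_ops_def cinner_sum_left cinner_scaleC_left mult.commute)
  then show ?thesis
    by (simp add: cinner_sum_left sum.cartesian_product split_beta)
qed

lemma mnorm_compression_diff:
  assumes "A \<in> mats n Y" "B \<in> mats n Y"
  shows "mnorm (scalar_mats k) n (\<lambda>p q. mat_fun k (compression Y y0 e) (A p q)
      - mat_fun k (compression Y y0 e) (B p q))
    = mat_opnorm ({..<n} \<times> {..<k}) (\<lambda>a b z.
        cinner (blinfun_apply (A (fst a) (fst b) - B (fst a) (fst b)) (e (snd b))) (e (snd a)) * z)"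
  unfolding mnorm_scalar_mats
proof (rule mat_opnorm_cong)
  fix a b :: "nat \<times> nat"
  assume "a \<in> {..<n} \<times> {..<k}" "b \<in> {..<n} \<times> {..<k}"
  then show "(\<lambda>z. (mat_fun k (compression Y y0 e) (A (fst a) (fst b))
      - mat_fun k (compression Y y0 e) (B (fst a) (fst b))) (snd a, snd b) * z)
    = (\<lambda>z. cinner (blinfun_apply (A (fst a) (fst b) - B (fst a) (fst b)) (e (snd b))) (e (snd a)) * z)"
    using assms
    by (auto simp: mats_def mat_fun_def compression_def blinfun.diff_left cinner_diff_left)
qed

lemma diff_bounded_ops: "S \<in> bounded_ops \<Longrightarrow> T \<in> bounded_ops \<Longrightarrow> S - T \<in> bounded_ops"
  by (simp add: bounded_ops_def blinfun.diff_left scaleC_diff_right)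

text \<open>The embedding of the span of the \<open>e\<^sub>j\<close> preserves norms and, by Bessel's inequality, the projection
  onto it does not increase them.\<close>

lemma mnorm_compression_le_1:
  assumes e: "orthonormal k e" and Y: "Y \<subseteq> bounded_ops"
  shows "mnorm (Lip0_space n Y y0) k (compression Y y0 e) \<le> 1"
  unfolding mnorm_Lip0_space
proof (rule lip_amp_le)
  fix A B assume AB: "A \<in> mats n Y" "B \<in> mats n Y"
  define M where "M = (\<lambda>p q. A p q - B p q)"
  have M: "M p q \<in> bounded_ops" if "p < n" "q < n" for p q
    using AB that Y by (auto simp: M_def mats_def intro!: diff_bounded_ops)
  have "mat_opnorm ({..<n} \<times> {..<k})
      (\<lambda>a b z. cinner (blinfun_apply (M (fst a) (fst b)) (e (snd b))) (e (snd a)) * z) \<le> op_mat_norm n M"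
  proof (rule mat_opnorm_le)
    fix z :: "nat \<times> nat \<Rightarrow> complex"
    assume z: "L2_set (\<lambda>b. cmod (z b)) ({..<n} \<times> {..<k}) \<le> 1"
    define w where "w = (\<lambda>q. \<Sum>j<k. z (q, j) *\<^sub>C e j)"
    define u where "u = (\<lambda>p. \<Sum>q<n. blinfun_apply (M p q) (w q))"
    have w: "L2_set (\<lambda>q. norm (w q)) {..<n} \<le> 1"
      using z unfolding L2_set_Times w_def L2_set_orthonormal_sum[OF e] .
    have "(\<Sum>b\<in>{..<n} \<times> {..<k}. cinner (blinfun_apply (M (fst a) (fst b)) (e (snd b))) (e (snd a)) * z b)
        = cinner (u (fst a)) (e (snd a))" if "a \<in> {..<n} \<times> {..<k}" for a
      unfolding u_def w_def by (rule compression_matrix_apply) (use M that in auto)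
    then have "L2_set (\<lambda>a. norm (\<Sum>b\<in>{..<n} \<times> {..<k}.
          cinner (blinfun_apply (M (fst a) (fst b)) (e (snd b))) (e (snd a)) * z b)) ({..<n} \<times> {..<k})
        = L2_set (\<lambda>a. norm (cinner (u (fst a)) (e (snd a)))) ({..<n} \<times> {..<k})"
      by (intro L2_set_cong) auto
    also have "\<dots> = L2_set (\<lambda>p. L2_set (\<lambda>i. cmod (cinner (u p) (e i))) {..<k}) {..<n}"
      by (simp add: L2_set_Times)
    also have "\<dots> \<le> L2_set (\<lambda>p. norm (u p)) {..<n}"
      by (intro L2_set_mono Bessel e) auto
    finally have "ennreal (L2_set (\<lambda>a. norm (\<Sum>b\<in>{..<n} \<times> {..<k}.
          cinner (blinfun_apply (M (fst a) (fst b)) (e (snd b))) (e (snd a)) * z b)) ({..<n} \<times> {..<k}))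
        \<le> ennreal (L2_set (\<lambda>p. norm (u p)) {..<n})"
      by (rule ennreal_leI)
    also have "\<dots> \<le> op_mat_norm n M"
      unfolding u_def op_mat_norm_def by (rule mat_opnorm_ge[OF w])
    finally show "ennreal (L2_set (\<lambda>a. norm (\<Sum>b\<in>{..<n} \<times> {..<k}.
          cinner (blinfun_apply (M (fst a) (fst b)) (e (snd b))) (e (snd a)) * z b)) ({..<n} \<times> {..<k}))
        \<le> op_mat_norm n M" .
  qed
  then show "mnorm (scalar_mats k) n (\<lambda>p q. mat_fun k (compression Y y0 e) (A p q)
      - mat_fun k (compression Y y0 e) (B p q)) \<le> 1 * op_mat_norm n (\<lambda>p q. A p q - B p q)"
    unfolding mnorm_compression_diff[OF AB] by (simp add: M_def)
qed

text \<open>For a given \<open>v\<close> choose the orthonormal system to span the components of \<open>v\<close> and of \<open>(A - B) v\<close>.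
  Then the compression of \<open>A - B\<close> maps the coefficients of \<open>v\<close> to those of \<open>(A - B) v\<close>, without loss
  of norm.\<close>

lemma op_mat_norm_le_Lip0_unit_ball:
  assumes Y: "Y \<subseteq> bounded_ops" and "y0 \<in> Y" and AB: "A \<in> mats n Y" "B \<in> mats n Y"
    and b: "\<And>k f. k \<ge> 1 \<Longrightarrow> f \<in> mats k (carr (Lip0_space n Y y0)) \<Longrightarrow>
      mnorm (Lip0_space n Y y0) k f \<le> 1 \<Longrightarrow>
      mnorm (scalar_mats k) n (\<lambda>p q. mat_fun k f (A p q) - mat_fun k f (B p q)) \<le> b"
  shows "op_mat_norm n (\<lambda>p q. A p q - B p q) \<le> b"
  unfolding op_mat_norm_def
proof (rule mat_opnorm_le)
  define M where "M = (\<lambda>p q. A p q - B p q)"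
  have M: "M p q \<in> bounded_ops" if "p < n" "q < n" for p q
    using AB that Y by (auto simp: M_def mats_def intro!: diff_bounded_ops)
  fix v :: "nat \<Rightarrow> 'a"
  assume v: "L2_set (\<lambda>j. norm (v j)) {..<n} \<le> 1"
  define u where "u = (\<lambda>p. \<Sum>q<n. blinfun_apply (M p q) (v q))"
  obtain k e where e: "orthonormal k e"
    and span: "\<And>s. s \<in> u ` {..<n} \<union> v ` {..<n} \<Longrightarrow> s = (\<Sum>i<k. cinner s (e i) *\<^sub>C e i)"
    using Gram_Schmidt[of "u ` {..<n} \<union> v ` {..<n}"] by (auto simp del: Un_iff)
  define z where "z = (\<lambda>b. cinner (v (fst b)) (e (snd b)))"
  have zv: "(\<Sum>j<k. z (q, j) *\<^sub>C e j) = v q" if "q < n" for q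
    using span[of "v q"] that by (simp add: z_def)
  have norm_u: "L2_set (\<lambda>i. cmod (cinner (u p) (e i))) {..<k} = norm (u p)" if "p < n" for p
    unfolding L2_set_orthonormal_sum[OF e] using span[of "u p"] that by simp
  have "ennreal (L2_set (\<lambda>p. norm (u p)) {..<n}) \<le> b"
  proof (cases "k \<ge> 1")
    case True
    have "L2_set (\<lambda>b. cmod (z b)) ({..<n} \<times> {..<k}) = L2_set (\<lambda>q. norm (v q)) {..<n}"
      unfolding L2_set_Times L2_set_orthonormal_sum[OF e] by (rule L2_set_cong) (simp_all add: zv)
    with v have z: "L2_set (\<lambda>b. cmod (z b)) ({..<n} \<times> {..<k}) \<le> 1"
      by simp
    have "(\<Sum>b\<in>{..<n} \<times> {..<k}. cinner (blinfun_apply (M (fst a) (fst b)) (e (snd b))) (e (snd a)) * z b)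
        = cinner (u (fst a)) (e (snd a))" if "a \<in> {..<n} \<times> {..<k}" for a
    proof -
      have "(\<Sum>b\<in>{..<n} \<times> {..<k}. cinner (blinfun_apply (M (fst a) (fst b)) (e (snd b))) (e (snd a)) * z b)
          = cinner (\<Sum>q<n. blinfun_apply (M (fst a) q) (\<Sum>j<k. z (q, j) *\<^sub>C e j)) (e (snd a))"
        by (rule compression_matrix_apply) (use M that in auto)
      then show ?thesis
        by (simp add: zv u_def)
    qed
    then have "L2_set (\<lambda>a. norm (\<Sum>b\<in>{..<n} \<times> {..<k}.
          cinner (blinfun_apply (M (fst a) (fst b)) (e (snd b))) (e (snd a)) * z b)) ({..<n} \<times> {..<k})
        = L2_set (\<lambda>a. norm (cinner (u (fst a)) (e (snd a)))) ({..<n} \<times> {..<k})"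
      by (intro L2_set_cong) auto
    also have "\<dots> = L2_set (\<lambda>p. L2_set (\<lambda>i. cmod (cinner (u p) (e i))) {..<k}) {..<n}"
      by (simp add: L2_set_Times)
    also have "\<dots> = L2_set (\<lambda>p. norm (u p)) {..<n}"
      by (intro L2_set_cong norm_u) auto
    finally have "ennreal (L2_set (\<lambda>p. norm (u p)) {..<n})
        = ennreal (L2_set (\<lambda>a. norm (\<Sum>b\<in>{..<n} \<times> {..<k}.
          cinner (blinfun_apply (M (fst a) (fst b)) (e (snd b))) (e (snd a)) * z b)) ({..<n} \<times> {..<k}))"
      by simp
    also have "\<dots> \<le> mat_opnorm ({..<n} \<times> {..<k})
        (\<lambda>a b z. cinner (blinfun_apply (M (fst a) (fst b)) (e (snd b))) (e (snd a)) * z)"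
      by (rule mat_opnorm_ge[OF z])
    also have "\<dots> \<le> b"
      using b[OF True compression_in_mats[OF e \<open>y0 \<in> Y\<close>] mnorm_compression_le_1[OF e Y]]
      unfolding mnorm_compression_diff[OF AB] M_def .
    finally show ?thesis .
  next
    \<comment> \<open>The system is empty if all the vectors vanish, whereas \<open>k \<ge> 1\<close> in the cb-norm.\<close>
    case False
    then have "norm (u p) = 0" if "p < n" for p
      using norm_u[OF that] by (simp add: not_le L2_set_def)
    then have "L2_set (\<lambda>p. norm (u p)) {..<n} = 0"
      by (intro L2_set_eq_0_iff[THEN iffD2]) auto
    then show ?thesis
      by simp
  qed
  then show "ennreal (L2_set (\<lambda>i. norm (\<Sum>j<n. blinfun_apply (A i j - B i j) (v j))) {..<n}) \<le> b"
    unfolding u_def M_def .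
qed

section \<open>Dual spaces and free spaces\<close>

lemma subspace_Lip0_space: "cfun.subspace (carr (Lip0_space n X x0))"
proof (rule cfun.subspaceI)
  show "0 \<in> carr (Lip0_space n X x0)"
    by (auto simp: carr_Lip0_space zero_fun_def lipschitz_on_def intro!: exI[of _ 0])
  fix f g assume "f \<in> carr (Lip0_space n X x0)" "g \<in> carr (Lip0_space n X x0)"
  then show "f + g \<in> carr (Lip0_space n X x0)"
    by (auto simp: carr_Lip0_space plus_fun_def intro: lipschitz_on_add)
qed (rule matrix_homogeneous.scale_closed[OF matrix_homogeneous_Lip0_space])

lemma carr_dual:
  "\<phi> \<in> carr (dual E) \<longleftrightarrow>
    (\<forall>f\<in>carr E. \<forall>g\<in>carr E. \<phi> (f + g) = \<phi> f + \<phi> g) \<and>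
    (\<forall>c. \<forall>f\<in>carr E. \<phi> (\<lambda>x. c * f x) = c * \<phi> f) \<and>
    (\<exists>C::real. \<forall>f\<in>carr E. ennreal (cmod (\<phi> f)) \<le> ennreal C * vnorm E f) \<and>
    (\<forall>f. f \<notin> carr E \<longrightarrow> \<phi> f = 0)"
  by (simp add: dual_def)

lemma mnorm_dual: "mnorm (dual E) k \<Phi> = cb_norm E (scalar_mats k) (mat_fun k \<Phi>)"
  by (simp add: dual_def)

lemma subspace_dual: "cfun.subspace (carr (dual E))"
proof (rule cfun.subspaceI)
  show "0 \<in> carr (dual E)"
    by (auto simp: carr_dual)
next
  fix \<phi> \<psi> assume \<phi>: "\<phi> \<in> carr (dual E)" and \<psi>: "\<psi> \<in> carr (dual E)"
  obtain C D :: real where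
    C: "\<forall>f\<in>carr E. ennreal (cmod (\<phi> f)) \<le> ennreal C * vnorm E f" and
    D: "\<forall>f\<in>carr E. ennreal (cmod (\<psi> f)) \<le> ennreal D * vnorm E f"
    using \<phi> \<psi> by (auto simp: carr_dual)
  have "ennreal (cmod (\<phi> f + \<psi> f)) \<le> ennreal (max C 0 + max D 0) * vnorm E f" if "f \<in> carr E" for f
  proof -
    have "ennreal (cmod (\<phi> f + \<psi> f)) \<le> ennreal (cmod (\<phi> f)) + ennreal (cmod (\<psi> f))"
      by (simp add: norm_triangle_ineq flip: ennreal_plus)
    also have "\<dots> \<le> ennreal C * vnorm E f + ennreal D * vnorm E f"
      using C D that by (intro add_mono) auto
    also have "\<dots> \<le> ennreal (max C 0) * vnorm E f + ennreal (max D 0) * vnorm E f"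
      by (intro add_mono mult_right_mono ennreal_leI) auto
    also have "\<dots> = ennreal (max C 0 + max D 0) * vnorm E f"
      by (simp add: ennreal_plus distrib_right)
    finally show ?thesis .
  qed
  then have bound: "\<exists>C::real. \<forall>f\<in>carr E. ennreal (cmod (\<phi> f + \<psi> f)) \<le> ennreal C * vnorm E f"
    by blast
  with \<phi> \<psi> show "\<phi> + \<psi> \<in> carr (dual E)"
    unfolding carr_dual plus_fun_apply by (simp add: algebra_simps)
next
  fix c \<phi> assume \<phi>: "\<phi> \<in> carr (dual E)"
  then obtain C :: real where
    C: "\<forall>f\<in>carr E. ennreal (cmod (\<phi> f)) \<le> ennreal C * vnorm E f"
    by (auto simp: carr_dual)
  have "ennreal (cmod (c * \<phi> f)) \<le> ennreal (cmod c * C) * vnorm E f" if "f \<in> carr E" for f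
  proof -
    have "ennreal (cmod (c * \<phi> f)) = ennreal (cmod c) * ennreal (cmod (\<phi> f))"
      by (simp add: norm_mult ennreal_mult)
    also have "\<dots> \<le> ennreal (cmod c) * (ennreal C * vnorm E f)"
      using C that by (intro mult_left_mono) auto
    also have "\<dots> = ennreal (cmod c * C) * vnorm E f"
      by (simp add: ennreal_mult' mult.assoc)
    finally show ?thesis .
  qed
  then have bound: "\<exists>C::real. \<forall>f\<in>carr E. ennreal (cmod (c * \<phi> f)) \<le> ennreal C * vnorm E f"
    by blast
  with \<phi> show "(\<lambda>f. c * \<phi> f) \<in> carr (dual E)"
    unfolding carr_dual by (simp add: algebra_simps)
qed

lemma mat_fun_in_scalar_mats: "mat_fun k \<Phi> f \<in> carr (scalar_mats k)"
  by (auto simp: scalar_mats_def mat_fun_def)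

lemma matrix_homogeneous_dual: "matrix_homogeneous (dual E)"
proof
  fix k and \<Phi> \<Psi> :: "nat \<Rightarrow> nat \<Rightarrow> ('a \<Rightarrow> complex) \<Rightarrow> complex"
  assume "\<And>i j. i < k \<Longrightarrow> j < k \<Longrightarrow> \<Phi> i j = \<Psi> i j"
  then have "mat_fun k \<Phi> = mat_fun k \<Psi>"
    by (auto simp: mat_fun_def fun_eq_iff)
  then show "mnorm (dual E) k \<Phi> = mnorm (dual E) k \<Psi>"
    unfolding mnorm_dual by simp
next
  fix k c and \<Phi> :: "nat \<Rightarrow> nat \<Rightarrow> ('a \<Rightarrow> complex) \<Rightarrow> complex"
  show "mnorm (dual E) k (\<lambda>i j f. c * \<Phi> i j f) \<le> ennreal (cmod c) * mnorm (dual E) k \<Phi>"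
    unfolding mnorm_dual
  proof (rule cb_norm_le)
    fix m A assume A: "m \<ge> 1" "A \<in> mats m (carr E)" "mnorm E m A \<le> 1"
    have "mnorm (scalar_mats k) m (\<lambda>p q. mat_fun k (\<lambda>i j f. c * \<Phi> i j f) (A p q))
        = mnorm (scalar_mats k) m (\<lambda>p q x. c * mat_fun k \<Phi> (A p q) x)"
      by (rule mnorm_scalar_mats_cong) (auto simp: mat_fun_def fun_eq_iff)
    also have "\<dots> \<le> ennreal (cmod c) * mnorm (scalar_mats k) m (\<lambda>p q. mat_fun k \<Phi> (A p q))"
      by (rule matrix_homogeneous.mnorm_scale[OF matrix_homogeneous_scalar_mats])
        (simp add: mats_def mat_fun_in_scalar_mats)
    also have "\<dots> \<le> ennreal (cmod c) * cb_norm E (scalar_mats k) (mat_fun k \<Phi>)"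
      by (intro mult_left_mono mnorm_le_cb_norm A) simp
    finally show "mnorm (scalar_mats k) m (\<lambda>p q. mat_fun k (\<lambda>i j f. c * \<Phi> i j f) (A p q))
        \<le> ennreal (cmod c) * cb_norm E (scalar_mats k) (mat_fun k \<Phi>)" .
  qed
qed (rule cfun.subspace_scale[OF subspace_dual])

lemma vnorm_dual_add: "vnorm (dual E) (\<phi> + \<psi>) \<le> vnorm (dual E) \<phi> + vnorm (dual E) \<psi>"
  unfolding vnorm_def mnorm_dual
proof (rule cb_norm_le)
  fix m A assume A: "m \<ge> 1" "A \<in> mats m (carr E)" "mnorm E m A \<le> 1"
  let ?M = "\<lambda>\<phi> p q. mat_fun 1 (\<lambda>_ _. \<phi>) (A p q)"
  have "mnorm (scalar_mats 1) m (?M (\<phi> + \<psi>))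
      = mnorm (scalar_mats 1) m (\<lambda>p q x. ?M \<phi> p q x + ?M \<psi> p q x)"
    by (rule mnorm_scalar_mats_cong) (auto simp: mat_fun_def fun_eq_iff)
  also have "\<dots> \<le> mnorm (scalar_mats 1) m (?M \<phi>) + mnorm (scalar_mats 1) m (?M \<psi>)"
    by (rule mnorm_scalar_mats_add)
  also have "\<dots> \<le> cb_norm E (scalar_mats 1) (mat_fun 1 (\<lambda>_ _. \<phi>))
      + cb_norm E (scalar_mats 1) (mat_fun 1 (\<lambda>_ _. \<psi>))"
    by (intro add_mono mnorm_le_cb_norm A)
  finally show "mnorm (scalar_mats 1) m (?M (\<phi> + \<psi>))
      \<le> cb_norm E (scalar_mats 1) (mat_fun 1 (\<lambda>_ _. \<phi>))
      + cb_norm E (scalar_mats 1) (mat_fun 1 (\<lambda>_ _. \<psi>))" .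
qed

lemma mnorm_mat_fun_le_dual:
  assumes "matrix_homogeneous E" and \<Phi>: "\<Phi> \<in> mats k (carr (dual E))"
    and "m \<ge> 1" "A \<in> mats m (carr E)" "mnorm E m A \<le> ennreal c" "0 < c"
  shows "mnorm (scalar_mats k) m (\<lambda>p q. mat_fun k \<Phi> (A p q)) \<le> ennreal c * mnorm (dual E) k \<Phi>"
  unfolding mnorm_dual
proof (rule mnorm_amp_le_cb_norm)
  fix a f assume "f \<in> carr E"
  then show "mat_fun k \<Phi> (\<lambda>x. a * f x) = (\<lambda>x. a * mat_fun k \<Phi> f x)"
    using \<Phi> by (auto simp: mat_fun_def fun_eq_iff mats_def carr_dual)
qed (use assms in \<open>auto simp: matrix_homogeneous_scalar_mats mat_fun_in_scalar_mats\<close>)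

lemma cmod_le_vnorm_dual:
  assumes "matrix_homogeneous E" "\<phi> \<in> carr (dual E)" "f \<in> carr E" "vnorm E f \<le> ennreal c" "0 < c"
  shows "ennreal (cmod (\<phi> f)) \<le> ennreal c * vnorm (dual E) \<phi>"
  using mnorm_mat_fun_le_dual[of E "\<lambda>_ _. \<phi>" 1 1 "\<lambda>_ _. f" c] assms
  unfolding mnorm_scalar_mats_1 by (simp add: mats_def vnorm_def mat_fun_def)

text \<open>The transpose of \<open>u\<close> on functionals, extended by zero off \<open>E\<close> as elements of \<^const>\<open>dual\<close> are.\<close>

definition adjoint :: "'c mat_normed_space \<Rightarrow> (('c \<Rightarrow> complex) \<Rightarrow> 'b) \<Rightarrow> ('b \<Rightarrow> complex) \<Rightarrow>
    ('c \<Rightarrow> complex) \<Rightarrow> complex"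
  where "adjoint E u \<phi> = (\<lambda>f. if f \<in> carr E then \<phi> (u f) else 0)"

lemma adjoint_add: "adjoint E u (\<phi> + \<psi>) = adjoint E u \<phi> + adjoint E u \<psi>"
  and adjoint_diff: "adjoint E u (\<phi> - \<psi>) = adjoint E u \<phi> - adjoint E u \<psi>"
  and adjoint_scale: "adjoint E u (\<lambda>g. c * \<phi> g) = (\<lambda>f. c * adjoint E u \<phi> f)"
  by (auto simp: adjoint_def fun_eq_iff)

lemma adjoint_in_dual:
  assumes E: "cfun.subspace (carr E)" and u: "linear_map E F u"
    and C: "0 \<le> C" "\<And>f. f \<in> carr E \<Longrightarrow> vnorm F (u f) \<le> ennreal C * vnorm E f"
    and \<phi>: "\<phi> \<in> carr (dual F)"
  shows "adjoint E u \<phi> \<in> carr (dual E)"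
proof -
  obtain D :: real where D: "\<forall>f\<in>carr F. ennreal (cmod (\<phi> f)) \<le> ennreal D * vnorm F f"
    using \<phi> by (auto simp: carr_dual)
  have uF: "u f \<in> carr F" if "f \<in> carr E" for f
    using u that by (auto simp: linear_map_def)
  have "ennreal (cmod (\<phi> (u f))) \<le> ennreal (D * C) * vnorm E f" if "f \<in> carr E" for f
  proof -
    have "ennreal (cmod (\<phi> (u f))) \<le> ennreal D * vnorm F (u f)"
      using D uF that by blast
    also have "\<dots> \<le> ennreal D * (ennreal C * vnorm E f)"
      by (intro mult_left_mono C that) simp
    finally show ?thesis
      using C(1) by (simp add: ennreal_mult'' mult.assoc)
  qed
  then have bound: "\<exists>C. \<forall>f\<in>carr E. ennreal (cmod (adjoint E u \<phi> f)) \<le> ennreal C * vnorm E f"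
    by (auto simp: adjoint_def)
  have "f + g \<in> carr E" "(\<lambda>x. c * f x) \<in> carr E" if "f \<in> carr E" "g \<in> carr E" for f g c
    using E that by (auto intro: cfun.subspace_add cfun.subspace_scale)
  with bound u \<phi> uF show ?thesis
    unfolding carr_dual linear_map_def by (simp add: adjoint_def)
qed

text \<open>Passing to adjoints does not increase cb-norms: \<open>[\<Phi>\<^sub>i\<^sub>j \<circ> u]\<close> at \<open>A\<close> is \<open>[\<Phi>\<^sub>i\<^sub>j]\<close> at \<open>u(A)\<close>. A bound
  \<open>c > 0\<close> takes the place of the cb-norm of \<open>u\<close>, which may be zero.\<close>

lemma mnorm_adjoint_le:
  assumes hom: "matrix_homogeneous F" and u: "linear_map E F u" and "0 < c"
    and bound: "\<And>m A. A \<in> mats m (carr E) \<Longrightarrow> mnorm E m A \<le> 1 \<Longrightarrow>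
      mnorm F m (\<lambda>p q. u (A p q)) \<le> ennreal c"
    and \<Phi>: "\<Phi> \<in> mats k (carr (dual F))"
  shows "mnorm (dual E) k (\<lambda>i j. adjoint E u (\<Phi> i j)) \<le> ennreal c * mnorm (dual F) k \<Phi>"
  unfolding mnorm_dual[of E]
proof (rule cb_norm_le)
  fix m A assume A: "m \<ge> 1" "A \<in> mats m (carr E)" "mnorm E m A \<le> 1"
  have "mnorm (scalar_mats k) m (\<lambda>p q. mat_fun k (\<lambda>i j. adjoint E u (\<Phi> i j)) (A p q))
      = mnorm (scalar_mats k) m (\<lambda>p q. mat_fun k \<Phi> (u (A p q)))"
    by (rule mnorm_scalar_mats_cong) (use A in \<open>auto simp: mat_fun_def adjoint_def mats_def\<close>)
  also have "\<dots> \<le> ennreal c * mnorm (dual F) k \<Phi>"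
    by (rule mnorm_mat_fun_le_dual) (use A u \<Phi> in \<open>auto simp: hom bound \<open>0 < c\<close> mats_def linear_map_def\<close>)
  finally show "mnorm (scalar_mats k) m (\<lambda>p q. mat_fun k (\<lambda>i j. adjoint E u (\<Phi> i j)) (A p q))
      \<le> ennreal c * mnorm (dual F) k \<Phi>" .
qed

lemma mnorm_free_space: "mnorm (free_space n X x0) = mnorm (dual (Lip0_space n X x0))"
  by (simp add: free_space_def Let_def)

lemma vnorm_free_space: "vnorm (free_space n X x0) = vnorm (dual (Lip0_space n X x0))"
  by (simp add: fun_eq_iff vnorm_def mnorm_free_space)

text \<open>Real and non-strict bounds are easier to halve and rescale than the strict ones of the definition.\<close>

lemma carr_free_space:
  "\<phi> \<in> carr (free_space n X x0) \<longleftrightarrow> \<phi> \<in> carr (dual (Lip0_space n X x0)) \<and>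
    (\<forall>e>0. \<exists>\<psi>\<in>cfun.span (evaluation n X x0 ` X).
      vnorm (dual (Lip0_space n X x0)) (\<phi> - \<psi>) \<le> ennreal e)"
  (is "?L \<longleftrightarrow> ?R")
proof
  assume ?L
  then have \<phi>: "\<phi> \<in> carr (dual (Lip0_space n X x0))"
    and small: "\<And>e. 0 < e \<Longrightarrow> \<exists>\<psi>\<in>cfun.span (evaluation n X x0 ` X).
      vnorm (dual (Lip0_space n X x0)) (\<phi> - \<psi>) < e"
    by (simp_all add: free_space_def Let_def)
  show ?R
  proof (intro conjI allI impI \<phi>)
    fix e :: real assume "0 < e"
    then show "\<exists>\<psi>\<in>cfun.span (evaluation n X x0 ` X).
        vnorm (dual (Lip0_space n X x0)) (\<phi> - \<psi>) \<le> ennreal e"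
      using small[of "ennreal e"] by (auto intro: less_imp_le)
  qed
next
  assume R: ?R
  have "\<exists>\<psi>\<in>cfun.span (evaluation n X x0 ` X). vnorm (dual (Lip0_space n X x0)) (\<phi> - \<psi>) < e"
    if "0 < e" for e :: ennreal
  proof -
    obtain d where d: "0 < d" "d < e"
      using dense \<open>0 < e\<close> by blast
    then obtain r where "d = ennreal r" "0 < r"
      by (cases d) (auto simp: ennreal_less_zero_iff)
    with R d show ?thesis
      by (meson order_le_less_trans)
  qed
  with R show ?L
    by (simp add: free_space_def Let_def)
qed

text \<open>Comparing the constant matrices with entries \<open>x\<close> and \<open>x\<^sub>0\<close> bounds \<open>f(x) = f(x) - f(x\<^sub>0)\<close> by a
  multiple of the norm of \<open>f\<close>.\<close>

lemma evaluation_in_dual: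
  assumes "n \<ge> 1" "x \<in> X" "x0 \<in> X"
  shows "evaluation n X x0 x \<in> carr (dual (Lip0_space n X x0))"
proof -
  let ?E = "Lip0_space n X x0"
  obtain d where d: "op_mat_norm n (\<lambda>_ _. x - x0) = ennreal d"
    using op_mat_norm_finite[of n "\<lambda>_ _. x - x0"] by (cases "op_mat_norm n (\<lambda>_ _. x - x0)") auto
  have "ennreal (cmod (f x)) \<le> ennreal d * vnorm ?E f" if f: "f \<in> carr ?E" for f
  proof -
    have "ennreal (cmod (f x)) \<le> mnorm (scalar_mats 1) n
        (\<lambda>_ _. mat_fun 1 (\<lambda>_ _. f) x - mat_fun 1 (\<lambda>_ _. f) x0)"
      using cmod_entry_le_mnorm_scalar_mats[of n 1 "\<lambda>_ _. mat_fun 1 (\<lambda>_ _. f) x - mat_fun 1 (\<lambda>_ _. f) x0"]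
        f \<open>n \<ge> 1\<close> by (simp add: mat_fun_def carr_Lip0_space)
    also have "\<dots> \<le> vnorm ?E f * ennreal d"
      using Lip0_space_apply[of "\<lambda>_ _. f" 1 n X x0 "\<lambda>_ _. x" "\<lambda>_ _. x0"] assms f d
      by (simp add: vnorm_def mats_def)
    finally show ?thesis
      by (simp add: mult.commute)
  qed
  then have "\<exists>C::real. \<forall>f\<in>carr ?E. ennreal (cmod (evaluation n X x0 x f)) \<le> ennreal C * vnorm ?E f"
    by (auto simp: evaluation_def)
  moreover have "f + g \<in> carr ?E" "(\<lambda>x. c * f x) \<in> carr ?E" if "f \<in> carr ?E" "g \<in> carr ?E" for f g c
    using subspace_Lip0_space that by (auto intro: cfun.subspace_add cfun.subspace_scale)
  ultimately show ?thesis
    unfolding carr_dual by (simp add: evaluation_def)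
qed

lemma span_evaluation_in_dual:
  assumes "n \<ge> 1" "x0 \<in> X" "\<psi> \<in> cfun.span (evaluation n X x0 ` X)"
  shows "\<psi> \<in> carr (dual (Lip0_space n X x0))"
  using cfun.span_minimal[OF _ subspace_dual, of "evaluation n X x0 ` X" "Lip0_space n X x0"]
    evaluation_in_dual[of n _ X x0] assms by blast

lemma free_space_subset_dual: "carr (free_space n X x0) \<subseteq> carr (dual (Lip0_space n X x0))"
  by (auto simp: carr_free_space)

lemma vnorm_dual_zero: "vnorm (dual E) 0 = 0"
proof -
  have "mnorm (dual E) 1 (\<lambda>i j f. 0 * (0 :: _ \<Rightarrow> complex) f) \<le> ennreal (cmod 0) * mnorm (dual E) 1 (\<lambda>_ _. 0)"
    by (rule matrix_homogeneous.mnorm_scale[OF matrix_homogeneous_dual])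
      (use cfun.subspace_0[OF subspace_dual] in \<open>simp add: mats_def zero_fun_def\<close>)
  then show ?thesis
    by (simp add: vnorm_def zero_fun_def)
qed

lemma span_evaluation_in_free_space:
  assumes "n \<ge> 1" "x0 \<in> X" "\<psi> \<in> cfun.span (evaluation n X x0 ` X)"
  shows "\<psi> \<in> carr (free_space n X x0)"
  unfolding carr_free_space
proof (intro conjI allI impI)
  fix e :: real
  show "\<exists>\<psi>'\<in>cfun.span (evaluation n X x0 ` X). vnorm (dual (Lip0_space n X x0)) (\<psi> - \<psi>') \<le> ennreal e"
    using assms(3) by (intro bexI[of _ \<psi>]) (simp_all add: vnorm_dual_zero)
qed (rule span_evaluation_in_dual[OF assms])

lemma subspace_free_space:
  assumes "n \<ge> 1" "x0 \<in> X"
  shows "cfun.subspace (carr (free_space n X x0))"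
proof (rule cfun.subspaceI)
  let ?S = "cfun.span (evaluation n X x0 ` X)" and ?D = "dual (Lip0_space n X x0)"
  show "0 \<in> carr (free_space n X x0)"
    by (intro span_evaluation_in_free_space assms cfun.span_zero)
  show "\<phi> + \<psi> \<in> carr (free_space n X x0)"
    if \<phi>: "\<phi> \<in> carr (free_space n X x0)" and \<psi>: "\<psi> \<in> carr (free_space n X x0)" for \<phi> \<psi>
    unfolding carr_free_space
  proof (intro conjI allI impI)
    show "\<phi> + \<psi> \<in> carr ?D"
      using \<phi> \<psi> by (auto simp: carr_free_space intro: cfun.subspace_add[OF subspace_dual])
    fix e :: real assume "0 < e"
    then have "0 < e / 2"
      by simp
    with \<phi> \<psi> obtain \<phi>' \<psi>' where in_span: "\<phi>' \<in> ?S" "\<psi>' \<in> ?S"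
      and le: "vnorm ?D (\<phi> - \<phi>') \<le> ennreal (e / 2)" "vnorm ?D (\<psi> - \<psi>') \<le> ennreal (e / 2)"
      unfolding carr_free_space by metis
    have "vnorm ?D ((\<phi> + \<psi>) - (\<phi>' + \<psi>')) = vnorm ?D ((\<phi> - \<phi>') + (\<psi> - \<psi>'))"
      by (simp add: algebra_simps)
    also have "\<dots> \<le> ennreal (e / 2) + ennreal (e / 2)"
      by (rule order_trans[OF vnorm_dual_add add_mono[OF le]])
    also have "\<dots> = ennreal e"
      using \<open>0 < e\<close> by (simp flip: ennreal_plus)
    finally show "\<exists>\<zeta>\<in>?S. vnorm ?D (\<phi> + \<psi> - \<zeta>) \<le> ennreal e"
      using in_span by (blast intro: cfun.span_add)
  qed
  show "(\<lambda>f. c * \<phi> f) \<in> carr (free_space n X x0)" if \<phi>: "\<phi> \<in> carr (free_space n X x0)" for c \<phi>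
    unfolding carr_free_space
  proof (intro conjI allI impI)
    show "(\<lambda>f. c * \<phi> f) \<in> carr ?D"
      using \<phi> by (auto simp: carr_free_space intro: cfun.subspace_scale[OF subspace_dual])
    fix e :: real assume "0 < e"
    have pos: "0 < cmod c + 1"
      by (simp add: add_nonneg_pos)
    with \<open>0 < e\<close> \<phi> obtain \<psi> where \<psi>: "\<psi> \<in> ?S" "vnorm ?D (\<phi> - \<psi>) \<le> ennreal (e / (cmod c + 1))"
      unfolding carr_free_space by (metis divide_pos_pos)
    have "vnorm ?D ((\<lambda>f. c * \<phi> f) - (\<lambda>f. c * \<psi> f)) = vnorm ?D (\<lambda>f. c * (\<phi> - \<psi>) f)"
      by (rule arg_cong[of _ _ "vnorm ?D"]) (simp add: fun_eq_iff right_diff_distrib)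
    also have "\<dots> \<le> ennreal (cmod c) * vnorm ?D (\<phi> - \<psi>)"
      unfolding vnorm_def
    proof (rule matrix_homogeneous.mnorm_scale[OF matrix_homogeneous_dual])
      have "\<phi> - \<psi> \<in> carr ?D"
        using \<phi> span_evaluation_in_dual[OF assms \<psi>(1)]
        by (intro cfun.subspace_diff[OF subspace_dual]) (auto simp: carr_free_space)
      then show "(\<lambda>_ _. \<phi> - \<psi>) \<in> mats 1 (carr ?D)"
        unfolding mats_def by blast
    qed
    also have "\<dots> \<le> ennreal (cmod c + 1) * ennreal (e / (cmod c + 1))"
      by (intro mult_mono \<psi> ennreal_leI) auto
    also have "\<dots> = ennreal e"
      using pos by (subst ennreal_mult'[symmetric]) simp_all
    finally show "\<exists>\<zeta>\<in>?S. vnorm ?D ((\<lambda>f. c * \<phi> f) - \<zeta>) \<le> ennreal e"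
      using cfun.span_scale[OF \<psi>(1)] by blast
  qed
qed

lemma matrix_homogeneous_free_space:
  assumes "n \<ge> 1" "x0 \<in> X"
  shows "matrix_homogeneous (free_space n X x0)"
proof -
  interpret D: matrix_homogeneous "dual (Lip0_space n X x0)"
    by (rule matrix_homogeneous_dual)
  have mats: "A \<in> mats k (carr (dual (Lip0_space n X x0)))" if "A \<in> mats k (carr (free_space n X x0))" for A k
    using that by (auto simp: mats_def carr_free_space)
  show ?thesis
  proof
    show "(\<lambda>x. c * f x) \<in> carr (free_space n X x0)" if "f \<in> carr (free_space n X x0)" for c f
      by (rule cfun.subspace_scale[OF subspace_free_space[OF assms] that])
  qed (auto simp: mnorm_free_space mats intro: D.mnorm_cong D.mnorm_scale)
qed

section \<open>The isometric embedding into the free space\<close>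

context
  fixes X :: "('h::complex_hilbert_space \<Rightarrow>\<^sub>L 'h) set" and x0 :: "'h \<Rightarrow>\<^sub>L 'h" and n :: nat
begin

text \<open>In the cb-norm of a matrix of functionals the index of \<open>M\<^sub>k(Lip\<^sub>0\<^sup>n)\<close> is the outer one, in the
  Lipschitz norm it is the inner one.\<close>

lemma mat_evaluation_diff:
  assumes f: "f \<in> mats k (carr (Lip0_space n X x0))"
  shows "mnorm (scalar_mats n) k (\<lambda>i j. mat_fun n
      (\<lambda>p q. evaluation n X x0 (A p q) - evaluation n X x0 (B p q)) (f i j))
    = mnorm (scalar_mats k) n (\<lambda>p q. mat_fun k f (A p q) - mat_fun k f (B p q))"
  unfolding mnorm_scalar_mats
  by (subst mat_opnorm_swap, rule mat_opnorm_cong)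
    (use f in \<open>auto simp: mats_def mat_fun_def evaluation_def\<close>)

lemma mnorm_evaluation_diff_le:
  assumes AB: "A \<in> mats n X" "B \<in> mats n X"
  shows "mnorm (free_space n X x0) n (\<lambda>p q. evaluation n X x0 (A p q) - evaluation n X x0 (B p q))
    \<le> op_mat_norm n (\<lambda>p q. A p q - B p q)"
  unfolding mnorm_free_space mnorm_dual
proof (rule cb_norm_le)
  fix k f assume f: "f \<in> mats k (carr (Lip0_space n X x0))" "mnorm (Lip0_space n X x0) k f \<le> 1"
  have "mnorm (scalar_mats k) n (\<lambda>p q. mat_fun k f (A p q) - mat_fun k f (B p q))
      \<le> mnorm (Lip0_space n X x0) k f * op_mat_norm n (\<lambda>p q. A p q - B p q)"
    by (rule Lip0_space_apply[OF f(1) AB])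
  also have "\<dots> \<le> 1 * op_mat_norm n (\<lambda>p q. A p q - B p q)"
    by (intro mult_right_mono f) simp
  finally show "mnorm (scalar_mats n) k (\<lambda>i j. mat_fun n
      (\<lambda>p q. evaluation n X x0 (A p q) - evaluation n X x0 (B p q)) (f i j))
      \<le> op_mat_norm n (\<lambda>p q. A p q - B p q)"
    unfolding mat_evaluation_diff[OF f(1)] by simp
qed

lemma mnorm_evaluation_diff_ge:
  assumes X: "X \<subseteq> bounded_ops" "x0 \<in> X" and AB: "A \<in> mats n X" "B \<in> mats n X"
  shows "op_mat_norm n (\<lambda>p q. A p q - B p q)
    \<le> mnorm (free_space n X x0) n (\<lambda>p q. evaluation n X x0 (A p q) - evaluation n X x0 (B p q))"
proof (rule op_mat_norm_le_Lip0_unit_ball[OF X AB])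
  fix k f assume k: "k \<ge> 1"
    and f: "f \<in> mats k (carr (Lip0_space n X x0))" "mnorm (Lip0_space n X x0) k f \<le> 1"
  show "mnorm (scalar_mats k) n (\<lambda>p q. mat_fun k f (A p q) - mat_fun k f (B p q))
    \<le> mnorm (free_space n X x0) n (\<lambda>p q. evaluation n X x0 (A p q) - evaluation n X x0 (B p q))"
    unfolding mat_evaluation_diff[OF f(1), symmetric] mnorm_free_space mnorm_dual
    by (rule mnorm_le_cb_norm[OF k f])
qed

end

section \<open>Lipschitz maps between pointed operator metric spaces\<close>

locale pointed_lipschitz_map =
  fixes X :: "('h::complex_hilbert_space \<Rightarrow>\<^sub>L 'h) set" and x0 :: "'h \<Rightarrow>\<^sub>L 'h"
    and Y :: "('k::complex_hilbert_space \<Rightarrow>\<^sub>L 'k) set" and y0 :: "'k \<Rightarrow>\<^sub>L 'k"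
    and n :: nat and L :: "('h \<Rightarrow>\<^sub>L 'h) \<Rightarrow> ('k \<Rightarrow>\<^sub>L 'k)"
  assumes X: "pointed_operator_metric_space X x0"
    and Y: "pointed_operator_metric_space Y y0"
    and n: "n \<ge> 1"
    and L: "L \<in> Lip0 X x0 Y y0"
begin

lemma base_points: "x0 \<in> X" "y0 \<in> Y" and Y_bounded: "Y \<subseteq> bounded_ops"
  using X Y by (auto simp: pointed_operator_metric_space_def)

lemma L_in: "x \<in> X \<Longrightarrow> L x \<in> Y" and L_base: "L x0 = y0"
  using L by (auto simp: Lip0_def)

lemma L_mats: "A \<in> mats m X \<Longrightarrow> (\<lambda>i j. L (A i j)) \<in> mats m Y"
  by (auto simp: mats_def L_in)

lemma Lip_n_L_finite: "Lip_n m X L < top"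
  using L by (auto simp: Lip0_def intro: Lip_n_finite)

abbreviation "LipX \<equiv> Lip0_space n X x0"
abbreviation "LipY \<equiv> Lip0_space n Y y0"
abbreviation "FX \<equiv> free_space n X x0"
abbreviation "FY \<equiv> free_space n Y y0"
abbreviation "L_adj \<equiv> adjoint LipY (pullback X L)"

lemma linear_pullback: "linear_map LipY LipX (pullback X L)"
  unfolding linear_map_def
proof (intro conjI ballI allI)
  obtain C where C: "C-lipschitz_on X L"
    using L by (auto simp: Lip0_def)
  show "pullback X L ` carr LipY \<subseteq> carr LipX"
  proof
    fix g assume "g \<in> pullback X L ` carr LipY"
    then obtain f where f: "f \<in> carr LipY" and g: "g = pullback X L f"
      by blast
    obtain D where D: "D-lipschitz_on Y f"
      using f by (auto simp: carr_Lip0_space)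
    then have "D-lipschitz_on (L ` X) f"
      by (rule lipschitz_on_subset) (auto simp: L_in)
    with C have "(D * C)-lipschitz_on X (\<lambda>x. f (L x))"
      using lipschitz_on_compose2 by blast
    then have "(D * C)-lipschitz_on X g"
      by (simp add: lipschitz_on_def g pullback_def)
    with f show "g \<in> carr LipX"
      by (auto simp: carr_Lip0_space g pullback_def L_base)
  qed
qed (auto simp: pullback_def fun_eq_iff)

lemma pullback_mats: "f \<in> mats k (carr LipY) \<Longrightarrow> (\<lambda>i j. pullback X L (f i j)) \<in> mats k (carr LipX)"
  using linear_pullback by (auto simp: mats_def linear_map_def)

lemma mat_fun_pullback:
  "x \<in> X \<Longrightarrow> mat_fun k (\<lambda>i j. pullback X L (f i j)) x = mat_fun k f (L x)"
  by (auto simp: mat_fun_def pullback_def fun_eq_iff)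

lemma mnorm_mat_fun_pullback:
  assumes "A \<in> mats n X" "B \<in> mats n X"
  shows "mnorm (scalar_mats k) n (\<lambda>p q. mat_fun k (\<lambda>i j. pullback X L (f i j)) (A p q)
      - mat_fun k (\<lambda>i j. pullback X L (f i j)) (B p q))
    = mnorm (scalar_mats k) n (\<lambda>p q. mat_fun k f (L (A p q)) - mat_fun k f (L (B p q)))"
  by (rule mnorm_scalar_mats_cong) (use assms in \<open>simp add: mats_def mat_fun_pullback\<close>)

lemma mnorm_pullback_le:
  assumes f: "f \<in> mats k (carr LipY)"
  shows "mnorm LipX k (\<lambda>i j. pullback X L (f i j)) \<le> mnorm LipY k f * Lip_n n X L"
  unfolding mnorm_Lip0_space[of _ X]
proof (rule lip_amp_le)
  fix A B assume AB: "A \<in> mats n X" "B \<in> mats n X"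
  have "mnorm (scalar_mats k) n (\<lambda>p q. mat_fun k f (L (A p q)) - mat_fun k f (L (B p q)))
      \<le> mnorm LipY k f * op_mat_norm n (\<lambda>p q. L (A p q) - L (B p q))"
    by (rule Lip0_space_apply[OF f L_mats[OF AB(1)] L_mats[OF AB(2)]])
  also have "\<dots> \<le> mnorm LipY k f * (Lip_n n X L * op_mat_norm n (\<lambda>p q. A p q - B p q))"
    by (intro mult_left_mono lip_amp_apply Lip_n_L_finite AB) simp
  finally show "mnorm (scalar_mats k) n (\<lambda>p q. mat_fun k (\<lambda>i j. pullback X L (f i j)) (A p q)
        - mat_fun k (\<lambda>i j. pullback X L (f i j)) (B p q))
      \<le> mnorm LipY k f * Lip_n n X L * op_mat_norm n (\<lambda>p q. A p q - B p q)"
    unfolding mnorm_mat_fun_pullback[OF AB] mult.assoc .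
qed

lemma mnorm_pullback_le_Lip_n:
  assumes "f \<in> mats k (carr LipY)" "mnorm LipY k f \<le> 1"
  shows "mnorm LipX k (\<lambda>i j. pullback X L (f i j)) \<le> Lip_n n X L"
  using mnorm_pullback_le[OF assms(1)] mult_right_mono[OF assms(2), of "Lip_n n X L"] by simp

text \<open>For the lower bound, the norming property turns the norm of \<open>L(A) - L(B)\<close> into values of pullbacks
  of functions in the unit ball.\<close>

theorem cb_norm_pullback: "cb_norm LipY LipX (pullback X L) = Lip_n n X L"
proof (rule antisym)
  show "cb_norm LipY LipX (pullback X L) \<le> Lip_n n X L"
    by (rule cb_norm_le) (rule mnorm_pullback_le_Lip_n)
  show "Lip_n n X L \<le> cb_norm LipY LipX (pullback X L)"
  proof (rule lip_amp_le)
    fix A B assume AB: "A \<in> mats n X" "B \<in> mats n X"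
    show "op_mat_norm n (\<lambda>p q. L (A p q) - L (B p q))
        \<le> cb_norm LipY LipX (pullback X L) * op_mat_norm n (\<lambda>p q. A p q - B p q)"
    proof (rule op_mat_norm_le_Lip0_unit_ball[OF Y_bounded base_points(2) L_mats[OF AB(1)] L_mats[OF AB(2)]])
      fix k f assume k: "k \<ge> 1" and f: "f \<in> mats k (carr LipY)" "mnorm LipY k f \<le> 1"
      have "mnorm (scalar_mats k) n (\<lambda>p q. mat_fun k f (L (A p q)) - mat_fun k f (L (B p q)))
          \<le> mnorm LipX k (\<lambda>i j. pullback X L (f i j)) * op_mat_norm n (\<lambda>p q. A p q - B p q)"
        unfolding mnorm_mat_fun_pullback[OF AB, symmetric]
        by (rule Lip0_space_apply[OF pullback_mats[OF f(1)] AB])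
      also have "\<dots> \<le> cb_norm LipY LipX (pullback X L) * op_mat_norm n (\<lambda>p q. A p q - B p q)"
        by (intro mult_right_mono mnorm_le_cb_norm k f) simp
      finally show "mnorm (scalar_mats k) n (\<lambda>p q. mat_fun k f (L (A p q)) - mat_fun k f (L (B p q)))
          \<le> cb_norm LipY LipX (pullback X L) * op_mat_norm n (\<lambda>p q. A p q - B p q)" .
    qed
  qed
qed

text \<open>The summand \<open>e\<close> keeps the constant positive when \<open>L\<close> is constant; in the cb-norm it disappears
  in the limit, and for boundedness \<open>e = 1\<close> is as good as any.\<close>

lemma mnorm_L_adj_le:
  assumes "\<Phi> \<in> mats k (carr (dual LipX))" "0 < e"
  shows "mnorm (dual LipY) k (\<lambda>i j. L_adj (\<Phi> i j))
    \<le> ennreal (enn2real (Lip_n n X L) + e) * mnorm (dual LipX) k \<Phi>"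
proof (rule mnorm_adjoint_le[OF matrix_homogeneous_Lip0_space linear_pullback])
  show "0 < enn2real (Lip_n n X L) + e"
    using \<open>0 < e\<close> by (simp add: add_nonneg_pos)
  fix m A assume A: "A \<in> mats m (carr LipY)" "mnorm LipY m A \<le> 1"
  have "Lip_n n X L = ennreal (enn2real (Lip_n n X L))"
    using Lip_n_L_finite[of n] by simp
  also have "\<dots> \<le> ennreal (enn2real (Lip_n n X L) + e)"
    using \<open>0 < e\<close> by (intro ennreal_leI) simp
  finally show "mnorm LipX m (\<lambda>p q. pullback X L (A p q)) \<le> ennreal (enn2real (Lip_n n X L) + e)"
    by (rule order_trans[OF mnorm_pullback_le_Lip_n[OF A]])
qed (rule assms)

abbreviation "bnd \<equiv> enn2real (Lip_n n X L) + 1"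

lemma bnd_pos: "0 < bnd"
  by (simp add: add_nonneg_pos)

lemma vnorm_L_adj_le:
  assumes "\<phi> \<in> carr (dual LipX)"
  shows "vnorm (dual LipY) (L_adj \<phi>) \<le> ennreal bnd * vnorm (dual LipX) \<phi>"
  unfolding vnorm_def using mnorm_L_adj_le[of "\<lambda>_ _. \<phi>" 1 1] assms by (simp add: mats_def)

lemma L_adj_in_dual:
  assumes "\<phi> \<in> carr (dual LipX)"
  shows "L_adj \<phi> \<in> carr (dual LipY)"
proof (rule adjoint_in_dual[OF subspace_Lip0_space linear_pullback _ _ assms])
  fix f assume "f \<in> carr LipY"
  then show "vnorm LipX (pullback X L f) \<le> ennreal (enn2real (Lip_n n X L)) * vnorm LipY f"
    using mnorm_pullback_le[of "\<lambda>_ _. f" 1] Lip_n_L_finite[of n]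
    by (simp add: vnorm_def mats_def mult.commute)
qed simp

lemma L_adj_evaluation:
  assumes "x \<in> X"
  shows "L_adj (evaluation n X x0 x) = evaluation n Y y0 (L x)"
  using linear_pullback assms
  by (auto simp: adjoint_def evaluation_def fun_eq_iff linear_map_def pullback_def)

lemma L_adj_span:
  assumes "\<psi> \<in> cfun.span (evaluation n X x0 ` X)"
  shows "L_adj \<psi> \<in> cfun.span (evaluation n Y y0 ` Y)"
  using assms
proof (induction rule: cfun.span_induct_alt)
  case base
  have "L_adj 0 = 0"
    by (auto simp: adjoint_def fun_eq_iff)
  then show ?case
    by (simp only: cfun.span_zero)
next
  case (step c \<phi> \<psi>)
  then obtain x where "x \<in> X" "\<phi> = evaluation n X x0 x"
    by blast
  then have "L_adj \<phi> \<in> cfun.span (evaluation n Y y0 ` Y)"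
    by (simp add: L_adj_evaluation L_in cfun.span_base)
  with step show ?case
    by (simp only: adjoint_add adjoint_scale) (intro cfun.span_add cfun.span_scale)
qed

lemma L_adj_in_free_space:
  assumes \<phi>: "\<phi> \<in> carr FX"
  shows "L_adj \<phi> \<in> carr FY"
  unfolding carr_free_space
proof (intro conjI allI impI)
  show "L_adj \<phi> \<in> carr (dual LipY)"
    using \<phi> by (simp add: carr_free_space L_adj_in_dual)
  fix e :: real assume "0 < e"
  then have "0 < e / bnd"
    using bnd_pos by simp
  then obtain \<psi> where \<psi>: "\<psi> \<in> cfun.span (evaluation n X x0 ` X)"
      "vnorm (dual LipX) (\<phi> - \<psi>) \<le> ennreal (e / bnd)"
    using \<phi> unfolding carr_free_space by blast
  have "vnorm (dual LipY) (L_adj \<phi> - L_adj \<psi>) = vnorm (dual LipY) (L_adj (\<phi> - \<psi>))"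
    by (simp only: adjoint_diff)
  also have "\<dots> \<le> ennreal bnd * vnorm (dual LipX) (\<phi> - \<psi>)"
    using \<phi> span_evaluation_in_dual[OF n base_points(1) \<psi>(1)]
    by (intro vnorm_L_adj_le cfun.subspace_diff[OF subspace_dual]) (simp_all add: carr_free_space)
  also have "\<dots> \<le> ennreal bnd * ennreal (e / bnd)"
    by (intro mult_left_mono \<psi>) simp
  also have "\<dots> = ennreal e"
    using bnd_pos by (subst ennreal_mult'[symmetric]) simp_all
  finally show "\<exists>\<psi>\<in>cfun.span (evaluation n Y y0 ` Y).
      vnorm (dual LipY) (L_adj \<phi> - \<psi>) \<le> ennreal e"
    using L_adj_span[OF \<psi>(1)] by blast
qed

definition Ltilde :: "((('h \<Rightarrow>\<^sub>L 'h) \<Rightarrow> complex) \<Rightarrow> complex) \<Rightarrow> ((('k \<Rightarrow>\<^sub>L 'k) \<Rightarrow> complex) \<Rightarrow> complex)"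
  where "Ltilde = restrict L_adj (carr FX)"

lemma evaluation_in_FX: "x \<in> X \<Longrightarrow> evaluation n X x0 x \<in> carr FX"
  by (rule span_evaluation_in_free_space[OF n base_points(1)]) (simp add: cfun.span_base)

lemma linearization_Ltilde: "linearization n X x0 Y y0 L Ltilde"
  unfolding linearization_def bounded_linear_map_def linear_map_def
proof (intro conjI ballI allI)
  note subX = subspace_free_space[OF n base_points(1)]
  show "Ltilde ` carr FX \<subseteq> carr FY"
    by (auto simp: Ltilde_def L_adj_in_free_space)
  show "Ltilde (\<phi> + \<psi>) = Ltilde \<phi> + Ltilde \<psi>" if "\<phi> \<in> carr FX" "\<psi> \<in> carr FX" for \<phi> \<psi>
    using that cfun.subspace_add[OF subX] by (simp add: Ltilde_def adjoint_add)
  show "Ltilde (\<lambda>f. c * \<phi> f) = (\<lambda>f. c * Ltilde \<phi> f)" if "\<phi> \<in> carr FX" for c \<phi>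
    using that cfun.subspace_scale[OF subX] by (simp add: Ltilde_def adjoint_scale)
  show "\<exists>C. \<forall>\<phi>\<in>carr FX. vnorm FY (Ltilde \<phi>) \<le> ennreal C * vnorm FX \<phi>"
    using vnorm_L_adj_le
    by (intro exI[of _ bnd]) (simp add: Ltilde_def vnorm_free_space carr_free_space)
  show "Ltilde \<in> extensional (carr FX)"
    by (simp add: Ltilde_def)
  show "evaluation n Y y0 (L x) = Ltilde (evaluation n X x0 x)" if "x \<in> X" for x
    using that by (simp add: Ltilde_def L_adj_evaluation evaluation_in_FX)
qed

lemma cb_norm_Ltilde_le: "cb_norm FX FY Ltilde \<le> Lip_n n X L"
proof (rule cb_norm_le)
  fix k \<Phi> assume \<Phi>: "\<Phi> \<in> mats k (carr FX)" "mnorm FX k \<Phi> \<le> 1"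
  show "mnorm FY k (\<lambda>i j. Ltilde (\<Phi> i j)) \<le> Lip_n n X L"
  proof (rule ennreal_le_epsilon)
    fix e :: real assume "0 < e"
    have "mnorm FY k (\<lambda>i j. Ltilde (\<Phi> i j)) = mnorm (dual LipY) k (\<lambda>i j. L_adj (\<Phi> i j))"
      unfolding mnorm_free_space
      by (rule matrix_homogeneous.mnorm_cong[OF matrix_homogeneous_dual])
        (use \<Phi> in \<open>simp add: mats_def Ltilde_def\<close>)
    also have "\<dots> \<le> ennreal (enn2real (Lip_n n X L) + e) * mnorm (dual LipX) k \<Phi>"
      by (rule mnorm_L_adj_le) (use \<Phi> \<open>0 < e\<close> in \<open>auto simp: mats_def carr_free_space\<close>)
    also have "\<dots> \<le> ennreal (enn2real (Lip_n n X L) + e) * 1"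
      using \<Phi> by (intro mult_left_mono) (simp_all add: mnorm_free_space)
    also have "\<dots> = Lip_n n X L + ennreal e"
      using Lip_n_L_finite[of n] \<open>0 < e\<close> by (simp add: ennreal_plus)
    finally show "mnorm FY k (\<lambda>i j. Ltilde (\<Phi> i j)) \<le> Lip_n n X L + ennreal e" .
  qed
qed

text \<open>Evaluation at a fixed \<open>g\<close> is continuous for the cb-norm of functionals. This lets density of the
  span be used for complex numbers instead of functionals.\<close>

lemma bounded_linear_map_pointwise_bound:
  assumes T: "bounded_linear_map FX FY T" and g: "g \<in> carr LipY"
  shows "\<exists>K\<ge>0. \<forall>\<zeta> e. \<zeta> \<in> carr FX \<longrightarrow> 0 \<le> e \<longrightarrow> vnorm FX \<zeta> \<le> ennreal e \<longrightarrow>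
    cmod (T \<zeta> g) \<le> K * e"
proof -
  obtain C :: real where C: "\<And>\<zeta>. \<zeta> \<in> carr FX \<Longrightarrow> vnorm FY (T \<zeta>) \<le> ennreal C * vnorm FX \<zeta>"
    using T unfolding bounded_linear_map_def by blast
  define c where "c = enn2real (vnorm LipY g) + 1"
  have c: "0 < c" "vnorm LipY g \<le> ennreal c"
    using mnorm_Lip0_space_finite[of "\<lambda>_ _. g" 1 n Y y0] g
    by (auto simp: c_def vnorm_def mats_def add_nonneg_pos ennreal_plus)
  have "cmod (T \<zeta> g) \<le> c * max C 0 * e"
    if \<zeta>: "\<zeta> \<in> carr FX" "vnorm FX \<zeta> \<le> ennreal e" and "0 \<le> e" for \<zeta> e
  proof -
    have "T \<zeta> \<in> carr (dual LipY)"
      using T \<zeta>(1) free_space_subset_dual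
      unfolding bounded_linear_map_def linear_map_def by blast
    then have "ennreal (cmod (T \<zeta> g)) \<le> ennreal c * vnorm (dual LipY) (T \<zeta>)"
      by (rule cmod_le_vnorm_dual[OF matrix_homogeneous_Lip0_space _ g c(2,1)])
    also have "\<dots> \<le> ennreal c * (ennreal C * vnorm FX \<zeta>)"
      using C[OF \<zeta>(1)] by (intro mult_left_mono) (simp_all add: vnorm_free_space)
    also have "\<dots> \<le> ennreal c * (ennreal (max C 0) * ennreal e)"
      by (intro mult_left_mono mult_mono ennreal_leI \<zeta>) simp_all
    also have "\<dots> = ennreal (c * max C 0 * e)"
      using c \<open>0 \<le> e\<close> by (simp add: ennreal_mult mult.assoc)
    finally show ?thesis
      using c \<open>0 \<le> e\<close> by (subst (asm) ennreal_le_iff) simp_all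
  qed
  with c show ?thesis
    by (intro exI[of _ "c * max C 0"]) auto
qed

text \<open>Two extensions agree on the span of the point evaluations; elsewhere their values at any \<open>g\<close>
  differ by arbitrarily little.\<close>

lemma linearization_unique:
  assumes S: "linearization n X x0 Y y0 L S" and T: "linearization n X x0 Y y0 L T"
  shows "S = T"
proof (rule extensionalityI[of S "carr FX" T])
  show "S \<in> extensional (carr FX)" "T \<in> extensional (carr FX)"
    using S T by (simp_all add: linearization_def)
  note subX = subspace_free_space[OF n base_points(1)]
  have bounded: "bounded_linear_map FX FY S" "bounded_linear_map FX FY T"
    using S T by (simp_all add: linearization_def)
  then have lin: "linear_map FX FY S" "linear_map FX FY T"
    by (simp_all add: bounded_linear_map_def)
  have "cfun.subspace {\<phi> \<in> carr FX. S \<phi> = T \<phi>}"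
  proof (rule cfun.subspaceI)
    have "S (0 + 0) = S 0 + S 0" "T (0 + 0) = T 0 + T 0"
      using lin cfun.subspace_0[OF subX] unfolding linear_map_def by blast+
    then have "S 0 = 0" "T 0 = 0"
      by simp_all
    then show "0 \<in> {\<phi> \<in> carr FX. S \<phi> = T \<phi>}"
      using cfun.subspace_0[OF subX] by simp
  qed (use lin in \<open>auto simp: linear_map_def cfun.subspace_add[OF subX] cfun.subspace_scale[OF subX]\<close>)
  moreover have "evaluation n X x0 ` X \<subseteq> {\<phi> \<in> carr FX. S \<phi> = T \<phi>}"
    using S T by (auto simp: linearization_def evaluation_in_FX)
  ultimately have span: "\<psi> \<in> carr FX" "S \<psi> = T \<psi>" if "\<psi> \<in> cfun.span (evaluation n X x0 ` X)" for \<psi>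
    using cfun.span_minimal that by blast+
  fix \<phi> assume \<phi>: "\<phi> \<in> carr FX"
  show "S \<phi> = T \<phi>"
  proof
    fix g
    have dual: "S \<phi> \<in> carr (dual LipY)" "T \<phi> \<in> carr (dual LipY)"
      using lin \<phi> by (auto simp: linear_map_def intro!: subsetD[OF free_space_subset_dual])
    show "S \<phi> g = T \<phi> g"
    proof (cases "g \<in> carr LipY")
      case False
      with dual show ?thesis
        by (simp add: carr_dual)
    next
      case True
      obtain K where K: "0 \<le> K" "\<And>\<zeta> e. \<zeta> \<in> carr FX \<Longrightarrow> 0 \<le> e \<Longrightarrow>
          vnorm FX \<zeta> \<le> ennreal e \<Longrightarrow> cmod (S \<zeta> g) \<le> K * e"
        using bounded_linear_map_pointwise_bound[OF bounded(1) True] by (elim exE conjE) simp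
      obtain K' where K': "0 \<le> K'" "\<And>\<zeta> e. \<zeta> \<in> carr FX \<Longrightarrow> 0 \<le> e \<Longrightarrow>
          vnorm FX \<zeta> \<le> ennreal e \<Longrightarrow> cmod (T \<zeta> g) \<le> K' * e"
        using bounded_linear_map_pointwise_bound[OF bounded(2) True] by (elim exE conjE) simp
      have "cmod (S \<phi> g - T \<phi> g) \<le> e" if "0 < e" for e
      proof -
        define d where "d = e / (K + K' + 1)"
        have d: "0 < d" "(K + K') * d \<le> e"
          using \<open>0 < e\<close> K(1) K'(1) by (auto simp: d_def field_simps)
        then obtain \<psi> where \<psi>: "\<psi> \<in> cfun.span (evaluation n X x0 ` X)"
            "vnorm (dual LipX) (\<phi> - \<psi>) \<le> ennreal d"
          using \<phi> unfolding carr_free_space by blast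
        define \<zeta> where "\<zeta> = \<phi> - \<psi>"
        have \<zeta>: "\<zeta> \<in> carr FX" "vnorm FX \<zeta> \<le> ennreal d" "\<phi> = \<psi> + \<zeta>"
          using \<psi> cfun.subspace_diff[OF subX \<phi> span(1)[OF \<psi>(1)]]
          by (simp_all add: \<zeta>_def vnorm_free_space)
        have "S \<phi> g - T \<phi> g = S \<zeta> g - T \<zeta> g"
          using lin \<zeta>(1) span[OF \<psi>(1)] unfolding \<zeta>(3) linear_map_def by simp
        also have "cmod \<dots> \<le> K * d + K' * d"
          using K(2)[OF \<zeta>(1) _ \<zeta>(2)] K'(2)[OF \<zeta>(1) _ \<zeta>(2)] d(1)
          by (intro order_trans[OF norm_triangle_ineq4 add_mono]) auto
        also have "\<dots> \<le> e"
          using d(2) by (simp add: distrib_right)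
        finally show ?thesis .
      qed
      then have "cmod (S \<phi> g - T \<phi> g) \<le> 0"
        by (rule field_le_epsilon[of _ 0, simplified])
      then show ?thesis
        by simp
    qed
  qed
qed

text \<open>An extension transports the isometric copy of \<open>A - B\<close> to that of \<open>L(A) - L(B)\<close>.\<close>

lemma Lip_n_le_cb_norm_linearization:
  assumes T: "linearization n X x0 Y y0 L T"
  shows "Lip_n n X L \<le> cb_norm FX FY T"
proof (rule lip_amp_le)
  fix A B assume AB: "A \<in> mats n X" "B \<in> mats n X"
  note subX = subspace_free_space[OF n base_points(1)]
  let ?\<delta> = "evaluation n X x0" and ?\<epsilon> = "evaluation n Y y0"
  let ?D = "\<lambda>p q. ?\<delta> (A p q) - ?\<delta> (B p q)"
  have lin: "linear_map FX FY T"
    using T by (simp add: linearization_def bounded_linear_map_def)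
  have T_diff: "T (\<phi> - \<psi>) = T \<phi> - T \<psi>" if "\<phi> \<in> carr FX" "\<psi> \<in> carr FX" for \<phi> \<psi>
  proof -
    have "T ((\<phi> - \<psi>) + \<psi>) = T (\<phi> - \<psi>) + T \<psi>"
      using lin that cfun.subspace_diff[OF subX] unfolding linear_map_def by blast
    then show ?thesis
      by (simp add: algebra_simps)
  qed
  have D: "?D \<in> mats n (carr FX)"
    using AB by (auto simp: mats_def intro!: cfun.subspace_diff[OF subX] evaluation_in_FX)
  obtain d where d: "0 \<le> d" "op_mat_norm n (\<lambda>p q. A p q - B p q) = ennreal d"
    using op_mat_norm_finite[of n "\<lambda>p q. A p q - B p q"]
    by (cases "op_mat_norm n (\<lambda>p q. A p q - B p q)") auto
  show "op_mat_norm n (\<lambda>p q. L (A p q) - L (B p q))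
      \<le> cb_norm FX FY T * op_mat_norm n (\<lambda>p q. A p q - B p q)"
  proof (cases "d = 0")
    case True
    have "op_mat_norm n (\<lambda>p q. L (A p q) - L (B p q))
        \<le> Lip_n n X L * op_mat_norm n (\<lambda>p q. A p q - B p q)"
      by (intro lip_amp_apply Lip_n_L_finite AB)
    with True d show ?thesis
      by simp
  next
    case False
    have "op_mat_norm n (\<lambda>p q. L (A p q) - L (B p q))
        \<le> mnorm FY n (\<lambda>p q. ?\<epsilon> (L (A p q)) - ?\<epsilon> (L (B p q)))"
      by (rule mnorm_evaluation_diff_ge[OF Y_bounded base_points(2) L_mats[OF AB(1)] L_mats[OF AB(2)]])
    also have "\<dots> = mnorm FY n (\<lambda>p q. T (?D p q))"
      using AB T
      by (intro matrix_homogeneous.mnorm_cong[OF matrix_homogeneous_free_space[OF n base_points(2)]])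
        (simp add: mats_def T_diff evaluation_in_FX linearization_def)
    also have "\<dots> \<le> ennreal d * cb_norm FX FY T"
    proof (rule mnorm_amp_le_cb_norm[OF _ _ _ _ n D])
      show "mnorm FX n ?D \<le> ennreal d"
        using mnorm_evaluation_diff_le[OF AB] d(2) by simp
    qed (use lin n d False base_points in
        \<open>auto simp: linear_map_def intro!: matrix_homogeneous_free_space\<close>)
    finally show ?thesis
      using d by (simp add: mult.commute)
  qed
qed

end

theorem lemma3p12:
  fixes X :: "('h::complex_hilbert_space \<Rightarrow>\<^sub>L 'h) set" and x0 :: "'h \<Rightarrow>\<^sub>L 'h"
    and Y :: "('k::complex_hilbert_space \<Rightarrow>\<^sub>L 'k) set" and y0 :: "'k \<Rightarrow>\<^sub>L 'k"
    and n :: nat and L :: "('h \<Rightarrow>\<^sub>L 'h) \<Rightarrow> ('k \<Rightarrow>\<^sub>L 'k)"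
  assumes "pointed_operator_metric_space X x0"
    and "pointed_operator_metric_space Y y0"
    and "n \<ge> 1"
    and "L \<in> Lip0 X x0 Y y0"
  shows "linear_map (Lip0_space n Y y0) (Lip0_space n X x0) (pullback X L)
    \<and> cb_norm (Lip0_space n Y y0) (Lip0_space n X x0) (pullback X L) = Lip_n n X L
    \<and> (\<exists>!T. linearization n X x0 Y y0 L T)
    \<and> (\<forall>T. linearization n X x0 Y y0 L T \<longrightarrow>
          cb_norm (free_space n X x0) (free_space n Y y0) T = Lip_n n X L)"
proof -
  interpret pointed_lipschitz_map X x0 Y y0 n L
    by unfold_locales (fact assms)+
  have "T = Ltilde" if "linearization n X x0 Y y0 L T" for T
    using linearization_unique[OF that linearization_Ltilde] .
  then show ?thesis
    using linear_pullback cb_norm_pullback linearization_Ltilde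
      antisym[OF cb_norm_Ltilde_le Lip_n_le_cb_norm_linearization[OF linearization_Ltilde]]
    by metis
qed

end
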